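(* The Riemann hypothesis (all nontrivial zeros of $\zeta$, i.e. those with $0<\Re s<1$, lie on $\Re s=\frac12$) is incompatible with the following twin prime formula; that is, the two cannot both hold. The formula: for $\sigma>1$, $x=L(p_j)-M(j+1)>0$, $R_0=L(p_j)\prod_{5\le p\le p_j}\left(1-\frac{2}{p}\right)$, and $T>0$ at least of order $x^c$ for some $0<c<1$, $$\pi_2(6x+1)=R_0+\frac{1}{2\pi i}\int_{\sigma-iT}^{\sigma+iT}\frac{\left(1-\frac{1}{2^s}\right)^{-2}x^s\,ds}{s\,\zeta(s)\prod_{2<p\le p_j}\left(1-\frac{2}{p^s}\right)D(s)}+O\left(\frac{\zeta^3(\sigma)x^{\sigma}}{T}\right)+O\left(\frac{x\log^3x}{T}\right)+O(1).$$
   Context: $p$ always denotes a prime and $p_j$ is the $j$th prime ($p_1=2,p_2=3,p_3=5,\dots$). $\zeta$ is the Riemann zeta function. $L(p_j)=\prod_{5\le p\le p_j}p$ and $M(j+1)=\frac16(p_{j+1}^2-1)$, so $x=L(p_j)-M(j+1)$ depends on $j$; only those $j$ with $x>0$ are considered. $\pi_2(6x+1)$ counts the ordinary twin prime pairs (pairs $6m\pm1$, both prime, with $m$ a positive integer) below $6x+1$; the pair $(3,5)$ is not of this form. The function $D$ is $$D(s)=\prod_{p>2}\left(1+\sum_{\nu=0}^\infty\frac{2^\nu}{p^{(\nu+2)s}}\right)=\prod_{p>2}\left(1+\frac{1}{p^s(p^s-2)}\right).$$ The implied constants in the $O$-terms do not depend on $j$, $x$ or $T$. *)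

theory Defs
  imports "HOL-Complex_Analysis.Complex_Analysis" "HOL-Computational_Algebra.Primes"
begin

section \<open>The Riemann zeta function on the right half-plane\<close>

text \<open>
  The zeta function is the analytic continuation of its Dirichlet series. The half-plane
  \<open>Re s > 0\<close>, punctured at the pole \<open>s = 1\<close>, contains the critical strip and all the points at
  which zeta is evaluated below; outside of this domain the value of the constant \<open>zeta\<close> is left
  unspecified. The lemmas below show that the continuation exists and is unique.
\<close>

definition is_zeta :: "(complex \<Rightarrow> complex) \<Rightarrow> bool" where
  "is_zeta f \<longleftrightarrow> f holomorphic_on ({s. Re s > 0} - {1}) \<and>
     (\<forall>s. Re s > 1 \<longrightarrow> (\<lambda>n. of_nat (Suc n) powr (-s)) sums f s)"

definition zeta :: "complex \<Rightarrow> complex" where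
  "zeta = (SOME f. is_zeta f)"

text \<open>
  Existence: \<open>zeta s - 1 / (s - 1)\<close> is the sum over \<open>m \<ge> 1\<close> of \<open>m powr (-s)\<close> minus the integral of
  \<open>u powr (-s)\<close> over \<open>[m, m + 1]\<close>, and this series converges locally uniformly for \<open>Re s > 0\<close>.
\<close>

definition zeta_term :: "nat \<Rightarrow> complex \<Rightarrow> complex" where
  "zeta_term n s = of_nat (Suc n) powr (-s) -
     (of_nat (Suc (Suc n)) powr (1 - s) - of_nat (Suc n) powr (1 - s)) / (1 - s)"

lemma norm_zeta_term_le:
  assumes s: "Re s > 0" "s \<noteq> 1"
  shows "cmod (zeta_term n s) \<le> cmod s * real (Suc n) powr (- Re s - 1)"
proof -
  define a where "a = real (Suc n)"
  have a: "a > 0" by (simp add: a_def)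
  define S where "S = closed_segment (complex_of_real a) (of_real (a + 1))"
  define B where "B = cmod s * a powr (- Re s - 1)"
  have B: "B \<ge> 0" by (simp add: B_def)
  have S: "\<exists>u. z = of_real u \<and> a \<le> u \<and> u \<le> a + 1" if "z \<in> S" for z
    using that a unfolding S_def closed_segment_of_real
    by (auto simp: closed_segment_eq_real_ivl split: if_splits)
  have pos: "z \<notin> \<real>\<^sub>\<le>\<^sub>0" if "z \<in> S" for z
    using S[OF that] a by (auto simp: complex_nonpos_Reals_iff)
  have ends: "of_real a \<in> S" "of_real (a + 1) \<in> S" by (simp_all add: S_def)
  have conv: "convex S" by (simp add: S_def)
  have dist: "cmod (z - of_real a) \<le> 1" if "z \<in> S" for z
    using S[OF that] by (auto simp flip: of_real_diff)
  have 1: "cmod (z powr (-s) - of_real a powr (-s)) \<le> B" if z: "z \<in> S" for z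
  proof -
    have "cmod (z powr (-s) - of_real a powr (-s)) \<le> B * cmod (z - of_real a)"
    proof (rule field_differentiable_bound[OF conv _ _ z ends(1)])
      show "((\<lambda>z. z powr (-s)) has_field_derivative (-s) * z powr (-s - 1)) (at z within S)"
        if "z \<in> S" for z
        using pos[OF that] by (rule has_field_derivative_at_within[OF has_field_derivative_powr])
      show "cmod ((-s) * z powr (-s - 1)) \<le> B" if w: "z \<in> S" for z
      proof -
        obtain u where u: "z = of_real u" "a \<le> u" using S[OF w] by blast
        have "cmod (z powr (-s - 1)) = u powr (- Re s - 1)"
          using u a by (simp add: norm_powr_real_powr)
        also have "\<dots> \<le> a powr (- Re s - 1)"
          using u a s by (intro powr_mono2') auto
        finally show ?thesis by (simp add: B_def norm_mult mult_left_mono)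
      qed
    qed
    also have "\<dots> \<le> B * 1" by (intro mult_left_mono dist[OF z] B)
    finally show ?thesis by simp
  qed
  define h where "h = (\<lambda>z::complex. z powr (1 - s) / (1 - s) - z * of_real a powr (-s))"
  have "cmod (h (of_real (a + 1)) - h (of_real a)) \<le> B * cmod (of_real (a + 1) - of_real a)"
  proof (rule field_differentiable_bound[OF conv _ _ ends(2) ends(1)])
    fix z assume z: "z \<in> S"
    show "(h has_field_derivative (z powr (-s) - of_real a powr (-s))) (at z within S)"
      unfolding h_def using pos[OF z] s
      by (auto intro!: derivative_eq_intros)
  qed (rule 1)
  also have "\<dots> = B" by (simp flip: of_real_diff)
  also have "h (of_real (a + 1)) - h (of_real a) = - zeta_term n s"
    by (simp add: h_def zeta_term_def a_def diff_divide_distrib ring_distribs add.commute)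
  finally show ?thesis by (simp add: B_def a_def)
qed

lemma summable_Suc_powr: "e < -1 \<Longrightarrow> summable (\<lambda>n. real (Suc n) powr e)"
  by (subst summable_Suc_iff) (simp add: summable_real_powr_iff)

lemma is_zeta_exists: "\<exists>f. is_zeta f"
proof -
  define S where "S = {s. Re s > 0} - {1::complex}"
  have oS: "open S"
    unfolding S_def by (intro open_delete open_halfspace_Re_gt)
  obtain g where g: "\<And>s. s \<in> S \<Longrightarrow> (\<lambda>n. zeta_term n s) sums g s"
    "\<And>s. s \<in> S \<Longrightarrow> g field_differentiable (at s)"
  proof (rule series_differentiable_comparison_complex[OF oS, of zeta_term])
    fix n s assume "s \<in> S"
    have "zeta_term n holomorphic_on S"
      unfolding zeta_term_def by (intro holomorphic_intros) (auto simp: S_def)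
    thus "zeta_term n field_differentiable (at s)"
      using oS \<open>s \<in> S\<close> by (simp add: holomorphic_on_imp_differentiable_at)
  next
    fix s assume s: "s \<in> S"
    define d where "d = Re s / 2"
    define h where "h = (\<lambda>n. complex_of_real ((cmod s + d) * real (Suc n) powr (- d - 1)))"
    have d: "d > 0" using s by (simp add: d_def S_def)
    have "summable h"
      unfolding h_def using d
      by (intro summable_of_real summable_mult summable_Suc_powr) auto
    moreover have "range h \<subseteq> \<real>\<^sub>\<ge>\<^sub>0"
      using d unfolding h_def image_subset_iff by (auto simp: nonneg_Reals_of_real_iff simp del: of_real_mult of_real_add of_nat_Suc)
    moreover have "cmod (zeta_term n y) \<le> cmod (h n)" if y: "y \<in> ball s d \<inter> S" for n y
    proof -
      have dist: "cmod (y - s) < d" using y by (simp add: dist_norm norm_minus_commute)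
      have "\<bar>Re y - Re s\<bar> < d" using dist abs_Re_le_cmod[of "y - s"] by simp
      hence re: "Re y \<ge> d" unfolding d_def by linarith
      have nm: "cmod y \<le> cmod s + d" using dist norm_triangle_ineq2[of y s] by linarith
      have "cmod (zeta_term n y) \<le> cmod y * real (Suc n) powr (- Re y - 1)"
        using y by (intro norm_zeta_term_le) (auto simp: S_def)
      also have "\<dots> \<le> (cmod s + d) * real (Suc n) powr (- d - 1)"
        using re nm d by (intro mult_mono powr_mono) auto
      also have "\<dots> = cmod (h n)"
        unfolding h_def norm_of_real using d by (simp add: abs_mult)
      finally show ?thesis .
    qed
    ultimately show "\<exists>d h. 0 < d \<and> summable h \<and> range h \<subseteq> \<real>\<^sub>\<ge>\<^sub>0 \<and>
        (\<forall>\<^sub>F n in sequentially. \<forall>y\<in>ball s d \<inter> S. cmod (zeta_term n y) \<le> cmod (h n))"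
      using d by (intro exI[of _ d] exI[of _ h] conjI always_eventually allI ballI)
  qed blast
  define f where "f = (\<lambda>s. g s + 1 / (s - 1))"
  have "g holomorphic_on S"
    using g(2) oS by (simp add: holomorphic_on_def field_differentiable_at_within)
  hence "f holomorphic_on S"
    unfolding f_def by (intro holomorphic_intros) (auto simp: S_def)
  moreover have "(\<lambda>n. of_nat (Suc n) powr (-s)) sums f s" if s: "Re s > 1" for s
  proof -
    have "(\<lambda>n. of_nat (Suc n) powr (1 - s) :: complex) \<longlonglongrightarrow> 0"
      using s by (intro tendsto_neg_powr_complex_of_nat filterlim_Suc) auto
    from sums_divide[OF telescope_sums[OF this], of "1 - s"]
    have "(\<lambda>n. (of_nat (Suc (Suc n)) powr (1 - s) - of_nat (Suc n) powr (1 - s)) / (1 - s))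
        sums ((0 - of_nat (Suc 0) powr (1 - s)) / (1 - s))" .
    moreover have "(0 - of_nat (Suc 0) powr (1 - s)) / (1 - s) = 1 / (s - 1)"
      using s minus_divide_divide[of 1 "s - 1"] by simp
    ultimately have "(\<lambda>n. (of_nat (Suc (Suc n)) powr (1 - s) - of_nat (Suc n) powr (1 - s)) / (1 - s))
        sums (1 / (s - 1))" by (simp only:)
    moreover have "(\<lambda>n. zeta_term n s) sums g s"
      using s by (intro g(1)) (auto simp: S_def)
    ultimately have "(\<lambda>n. zeta_term n s +
        (of_nat (Suc (Suc n)) powr (1 - s) - of_nat (Suc n) powr (1 - s)) / (1 - s)) sums f s"
      unfolding f_def by (intro sums_add)
    thus ?thesis by (simp only: zeta_term_def diff_add_cancel)
  qed
  ultimately show ?thesis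
    unfolding is_zeta_def S_def by blast
qed

lemma is_zeta_zeta: "is_zeta zeta"
  unfolding zeta_def using is_zeta_exists by (rule someI_ex)

lemma is_zeta_unique:
  assumes f: "is_zeta f" and s: "Re s > 0" "s \<noteq> 1"
  shows "f s = zeta s"
proof (rule analytic_continuation_open[of "{s. Re s > 1}" "{s. Re s > 0} - {1}" f zeta])
  show "f z = zeta z" if "z \<in> {s. Re s > 1}" for z
    using f is_zeta_zeta that unfolding is_zeta_def by (metis mem_Collect_eq sums_unique2)
  show "connected ({s. Re s > 0} - {1})"
    by (intro connected_open_delete open_halfspace_Re_gt convex_connected convex_halfspace_Re_gt)
       auto
  show "{s. Re s > 1} \<noteq> {}" by (auto intro!: exI[of _ 2])
qed (use f is_zeta_zeta s in \<open>auto simp: is_zeta_def open_halfspace_Re_gt open_delete\<close>)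

definition riemann_hypothesis :: bool where
  "riemann_hypothesis \<longleftrightarrow> (\<forall>s. 0 < Re s \<and> Re s < 1 \<and> zeta s = 0 \<longrightarrow> Re s = 1 / 2)"


section \<open>The twin prime formula\<close>

text \<open>Primes are numbered from 1: \<open>nth_prime 1 = 2\<close>; only indices \<open>j \<ge> 1\<close> are used.\<close>

definition nth_prime :: "nat \<Rightarrow> nat" where
  "nth_prime j = enumerate {p. prime p} (j - 1)"

definition L_prod :: "nat \<Rightarrow> real" where
  "L_prod q = (\<Prod>p | prime p \<and> 5 \<le> p \<and> p \<le> q. real p)"

definition M_of :: "nat \<Rightarrow> real" where
  "M_of j = (real (nth_prime j) ^ 2 - 1) / 6"

definition x_of :: "nat \<Rightarrow> real" where
  "x_of j = L_prod (nth_prime j) - M_of (j + 1)"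

definition R0 :: "nat \<Rightarrow> real" where
  "R0 j = L_prod (nth_prime j) * (\<Prod>p | prime p \<and> 5 \<le> p \<and> p \<le> nth_prime j. 1 - 2 / real p)"

text \<open>Twin prime pairs \<open>(6 m - 1, 6 m + 1)\<close> with \<open>m \<ge> 1\<close>, both members below \<open>y\<close>.\<close>

definition twin_pi :: "real \<Rightarrow> nat" where
  "twin_pi y = card {m::nat. m \<ge> 1 \<and> prime (6 * m - 1) \<and> prime (6 * m + 1) \<and> real (6 * m + 1) < y}"

definition D_prod :: "complex \<Rightarrow> complex" where
  "D_prod s = (\<Prod>p. if prime p \<and> p > 2
                then 1 + (\<Sum>\<nu>. 2 ^ \<nu> / of_nat p powr (of_nat (\<nu> + 2) * s)) else 1)"

lemma D_factor:
  assumes "Re s > 1" and "p > (2::nat)"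
  shows "1 + (\<Sum>\<nu>. 2 ^ \<nu> / of_nat p powr (of_nat (\<nu> + 2) * s)) =
         1 + 1 / (of_nat p powr s * (of_nat p powr s - 2) :: complex)"
proof -
  define q :: complex where "q = of_nat p powr s"
  have "cmod q = real p powr Re s"
    unfolding q_def using assms by (subst norm_powr_real_powr) auto
  also have "\<dots> > real p powr 1"
    using assms by (intro powr_less_mono) auto
  finally have q: "cmod q > 2" using assms by simp
  have q0: "q \<noteq> 0" "q \<noteq> 2" using q by auto
  have "(\<lambda>\<nu>. (1 / q ^ 2) * (2 / q) ^ \<nu>) sums ((1 / q ^ 2) * (1 / (1 - 2 / q)))"
    using q by (intro sums_mult geometric_sums) (simp add: norm_divide divide_less_eq)
  also have "(1 / q ^ 2) * (1 / (1 - 2 / q)) = 1 / (q * (q - 2))"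
    using q0 by (simp add: field_simps power2_eq_square)
  also have "(\<lambda>\<nu>. (1 / q ^ 2) * (2 / q) ^ \<nu>) = (\<lambda>\<nu>. 2 ^ \<nu> / of_nat p powr (of_nat (\<nu> + 2) * s))"
  proof
    fix \<nu> :: nat
    have "of_nat p powr (of_nat (\<nu> + 2) * s) = q ^ (\<nu> + 2)"
      using assms exp_of_nat_mult[of "\<nu> + 2" "s * Ln (of_nat p)"]
      by (simp add: q_def powr_def mult.assoc)
    thus "(1 / q ^ 2) * (2 / q) ^ \<nu> = 2 ^ \<nu> / of_nat p powr (of_nat (\<nu> + 2) * s)"
      by (simp add: power_divide power_add power2_eq_square)
  qed
  finally show ?thesis by (simp add: q_def sums_iff)
qed

definition integrand :: "nat \<Rightarrow> complex \<Rightarrow> complex" where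
  "integrand j s =
     inverse ((1 - 1 / 2 powr s) ^ 2) * of_real (x_of j) powr s /
       (s * zeta s * (\<Prod>p | prime p \<and> 2 < p \<and> p \<le> nth_prime j. 1 - 2 / of_nat p powr s) * D_prod s)"

definition twin_error :: "nat \<Rightarrow> real \<Rightarrow> real \<Rightarrow> complex" where
  "twin_error j \<sigma> T =
     of_nat (twin_pi (6 * x_of j + 1)) - of_real (R0 j) -
     1 / (2 * of_real pi * \<i>) *
       contour_integral (linepath (Complex \<sigma> (-T)) (Complex \<sigma> T)) (integrand j)"

text \<open>
  The constants \<open>C\<^sub>1\<close>, \<open>C\<^sub>2\<close>, \<open>C\<^sub>3\<close> implied in the three error terms are uniform in \<open>j\<close> (hence in
  \<open>x\<close>) and \<open>T\<close>. The condition that \<open>T\<close> is at least of order \<open>x powr c\<close> is \<open>T \<ge> \<kappa> * x powr c\<close>.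
\<close>

definition twin_prime_formula :: bool where
  "twin_prime_formula \<longleftrightarrow>
     (\<forall>\<sigma>>1. \<exists>c \<kappa> C\<^sub>1 C\<^sub>2 C\<^sub>3. 0 < c \<and> c < 1 \<and> 0 < \<kappa> \<and>
        (\<forall>j T. j \<ge> 1 \<and> x_of j > 0 \<and> T > 0 \<and> T \<ge> \<kappa> * x_of j powr c \<longrightarrow>
           cmod (twin_error j \<sigma> T) \<le>
             C\<^sub>1 * (cmod (zeta (of_real \<sigma>)) ^ 3 * x_of j powr \<sigma> / T) +
             C\<^sub>2 * (x_of j * ln (x_of j) ^ 3 / T) + C\<^sub>3))"

end

theory Submission
  imports Defs "HOL-Real_Asymp.Real_Asymp" "HOL-Computational_Algebra.Squarefree"
begin

text \<open>
  For \<open>\<sigma> = 21/20\<close> and \<open>T\<close> a constant multiple of \<open>x\<close> the error terms of the formula are at most about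
  \<open>x powr (1/20)\<close>. Under the Riemann hypothesis the integrand continues to \<open>Re s > 4/5\<close>, where
  \<open>1 / zeta\<close> grows slower than any power of \<open>\<bar>Im s\<bar>\<close>, the factor \<open>1 / D\<close> is bounded, and the product over
  \<open>p \<le> p\<^sub>j\<close> contributes at most \<open>6 ^ j\<close>, which is smaller than any power of \<open>x\<close> since \<open>x\<close> grows like a
  product of \<open>j\<close> primes. Moving the path of integration to \<open>Re s = 9/10\<close> thus shows that the integral
  is \<open>O(x powr (97/100))\<close>. So the formula forces \<open>\<pi>\<^sub>2(6x + 1)\<close> to be asymptotic to the main term \<open>R\<^sub>0\<close>.
  But \<open>R\<^sub>0\<close> is at least of order \<open>x / (log x) powr (2/3)\<close>, while \<open>\<pi>\<^sub>2(6x + 1)\<close> is \<open>O(x / log x)\<close> by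
  Chebyshev's bound for the number of primes.
\<close>

section \<open>Primes\<close>

text \<open>The two orders clash because \<open>R0\<close> sieves only by the primes up to
  \<open>nth_prime j\<close>, whose size is about log x, so it loses less than one power of log x,
  while a count of primes loses a full one. Crude bounds are therefore enough. The exponent 2/3
  arises because the primes from 5 on occupy two of the six classes modulo 6: the m-th of them is at
  least about 3 m, a product of factors \<open>1 - 2 / (3 * m + 1)\<close> decays like the power
  -2/3, and j is at most log x. The path cannot be moved arbitrarily far:
  \<open>1 - 2 / p powr s\<close> vanishes where \<open>p powr s = 2\<close>, for p = 3 on Re s =
  log 2 / log 3. To the right of 4/5 these factors stay away from 0 uniformly in p. No residue
  appears, since the pole of zeta at 1 is a zero of its reciprocal. T proportional to x is
  admissible for every c < 1.\<close>

lemma prime_nth_prime: "prime (nth_prime j)"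
  using enumerate_in_set[OF primes_infinite] by (simp add: nth_prime_def)

lemma nth_prime_less: "i < j \<Longrightarrow> 1 \<le> i \<Longrightarrow> nth_prime i < nth_prime j"
  by (simp add: nth_prime_def primes_infinite)

lemma nth_prime_exhaust:
  assumes "prime p"
  obtains i where "i \<ge> 1" "nth_prime i = p"
proof -
  have "p \<in> {p. prime p}" using assms by simp
  then obtain n where "enumerate {p::nat. prime p} n = p"
    using enumerate_Ex[OF primes_infinite] by blast
  thus ?thesis by (intro that[of "Suc n"]) (auto simp: nth_prime_def)
qed

lemma nth_prime_le_iff: "1 \<le> i \<Longrightarrow> 1 \<le> j \<Longrightarrow> nth_prime i \<le> nth_prime j \<longleftrightarrow> i \<le> j"
  by (metis linorder_not_le nth_prime_less order.order_iff_strict order_less_imp_le)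

lemma primes_le_nth_prime: "1 \<le> j \<Longrightarrow> {p. prime p \<and> p \<le> nth_prime j} = nth_prime ` {1..j}"
  by (auto simp: nth_prime_le_iff prime_nth_prime elim!: nth_prime_exhaust)

lemma inj_on_nth_prime: "inj_on nth_prime {1..}"
  by (intro strict_mono_on_imp_inj_on strict_mono_onI) (auto intro: nth_prime_less)

lemma card_primes_le_nth_prime: "1 \<le> j \<Longrightarrow> card {p. prime p \<and> p \<le> nth_prime j} = j"
  by (simp add: primes_le_nth_prime card_image inj_on_subset[OF inj_on_nth_prime])

lemma primes_le_nth_prime_Suc:
  assumes "1 \<le> j"
  shows "{p. prime p \<and> p \<le> nth_prime (Suc j)} = insert (nth_prime (Suc j)) {p. prime p \<and> p \<le> nth_prime j}"
  using assms by (simp add: primes_le_nth_prime atLeastAtMostSuc_conv)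

lemma prime_less_5: "prime p \<Longrightarrow> p < 5 \<longleftrightarrow> p \<in> {2, 3::nat}"
proof -
  assume p: "prime p"
  have "p = 0 \<or> p = 1 \<or> p = 2 \<or> p = 3 \<or> p = 4" if "p < 5" using that by linarith
  moreover have "\<not> prime (4::nat)" by (auto simp: prime_nat_iff intro!: exI[of _ 2])
  ultimately show ?thesis using p by (auto)
qed

lemma nth_prime_ge_5: 
  assumes "j \<ge> 3" shows "nth_prime j \<ge> 5"
proof (rule ccontr)
  assume "\<not> ?thesis"
  hence "{p. prime p \<and> p \<le> nth_prime j} \<subseteq> {2, 3}"
    using prime_less_5 by (auto simp: not_le dest: order.strict_trans1)
  hence "card {p. prime p \<and> p \<le> nth_prime j} \<le> card {2, 3::nat}"
    by (intro card_mono) auto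
  thus False using card_primes_le_nth_prime[of j] assms by simp
qed

text \<open>Anchors the inductions that start at j = 2, where no prime from 5 on has been used
  yet.\<close>

lemma nth_prime_2: "nth_prime 2 = 3"
proof -
  have "nth_prime 2 < 5"
  proof (rule ccontr)
    assume *: "\<not> ?thesis"
    have "card {2, 3, nth_prime 2} \<le> card {p. prime p \<and> p \<le> nth_prime 2}"
      using * by (intro card_mono) (auto simp: prime_nth_prime)
    thus False using * by (simp add: card_primes_le_nth_prime)
  qed
  hence "nth_prime 2 \<in> {2, 3}" using prime_less_5 prime_nth_prime by blast
  moreover have "nth_prime 2 > nth_prime 1" by (rule nth_prime_less) auto
  moreover have "nth_prime 1 \<ge> 2" using prime_ge_2_nat prime_nth_prime by blast
  ultimately show ?thesis by auto
qed

section \<open>The primes from 5 to \<open>nth_prime j\<close> and their spacing\<close>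

abbreviation mid_primes :: "nat \<Rightarrow> nat set" where
  "mid_primes j \<equiv> {p. prime p \<and> 5 \<le> p \<and> p \<le> nth_prime j}"

lemma mid_primes_2: "mid_primes 2 = {}"
  by (auto simp: nth_prime_2)

lemma mid_primes_Suc:
  assumes "j \<ge> 2"
  shows "mid_primes (Suc j) = insert (nth_prime (Suc j)) (mid_primes j)" "nth_prime (Suc j) \<notin> mid_primes j"
proof -
  show "nth_prime (Suc j) \<notin> mid_primes j" using nth_prime_less[of j "Suc j"] assms by auto
  have "mid_primes i = {p. prime p \<and> p \<le> nth_prime i} \<inter> {5..}" for i by auto
  thus "mid_primes (Suc j) = insert (nth_prime (Suc j)) (mid_primes j)"
    using primes_le_nth_prime_Suc[of j] nth_prime_ge_5[of "Suc j"] assms by auto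
qed

lemma card_mid_primes: "j \<ge> 2 \<Longrightarrow> card (mid_primes j) = j - 2"
proof (induction j rule: dec_induct)
  case base
  show ?case by (simp only: mid_primes_2 card.empty)
next
  case (step j)
  have "finite (mid_primes j)" by simp
  thus ?case using step mid_primes_Suc[of j] by simp
qed

text \<open>The primes from 5 on are prime to 6, so they are of the form \<open>3 m + 1\<close>, \<open>m\<close> even, or \<open>3 m + 2\<close>, \<open>m\<close> odd.\<close>

lemma inj_on_div_3_mid_primes: "inj_on (\<lambda>p. p div 3) (mid_primes j)"
proof (rule inj_onI)
  have *: "\<exists>a e. e \<le> 1 \<and> p = 6 * a + 4 * e + 1 \<and> p div 3 = 2 * a + e"
    if "p \<in> mid_primes j" for p
  proof -
    have "\<not> 2 dvd p" "\<not> 3 dvd p" using that by (auto dest: primes_dvd_imp_eq[rotated 2])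
    hence "p mod 6 = 1 \<or> p mod 6 = 5" by presburger
    moreover have "p = 6 * (p div 6) + p mod 6" by simp
    ultimately have "p = 6 * (p div 6) + 1 \<or> p = 6 * (p div 6) + 5" by metis
    thus ?thesis
    proof
      assume "p = 6 * (p div 6) + 1"
      thus ?thesis by (intro exI[of _ "p div 6"] exI[of _ 0]) linarith
    next
      assume "p = 6 * (p div 6) + 5"
      thus ?thesis by (intro exI[of _ "p div 6"] exI[of _ 1]) linarith
    qed
  qed
  fix p q assume pq: "p \<in> mid_primes j" "q \<in> mid_primes j" "p div 3 = q div 3"
  obtain a b e f where "e \<le> 1" "p = 6 * a + 4 * e + 1" "p div 3 = 2 * a + e"
    "f \<le> 1" "q = 6 * b + 4 * f + 1" "q div 3 = 2 * b + f"
    using *[OF pq(1)] *[OF pq(2)] by blast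
  moreover from this have "2 * a + e = 2 * b + f" using pq by simp
  hence "a = b \<and> e = f" using \<open>e \<le> 1\<close> \<open>f \<le> 1\<close> by presburger
  ultimately show "p = q" by simp
qed

text \<open>The injection \<open>p div 3\<close> gives j - 2 <= \<open>nth_prime j div 3\<close>,
  and since 3 does not divide the prime, one more unit is gained: 3 (j - 2) + 1.\<close>

lemma nth_prime_ge:
  assumes "j \<ge> 3" shows "nth_prime j \<ge> 3 * j - 5"
proof -
  have "card (mid_primes j) \<le> card {1..nth_prime j div 3}"
  proof (rule card_inj_on_le[OF inj_on_div_3_mid_primes])
    show "(\<lambda>p. p div 3) ` mid_primes j \<subseteq> {1..nth_prime j div 3}"
      by (auto simp: div_le_mono)
  qed auto
  hence "j - 2 \<le> nth_prime j div 3" using card_mid_primes[of j] assms by simp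
  moreover have "\<not> 3 dvd nth_prime j"
    using nth_prime_ge_5[OF assms] by (auto dest: primes_dvd_imp_eq[rotated 2] simp: prime_nth_prime)
  ultimately show ?thesis by presburger
qed

section \<open>Growth of x, and the main term from below\<close>

lemma L_prod_Suc:
  "j \<ge> 2 \<Longrightarrow> L_prod (nth_prime (Suc j)) = real (nth_prime (Suc j)) * L_prod (nth_prime j)"
  unfolding L_prod_def using mid_primes_Suc[of j] by simp

text \<open>Every new prime is at least its index; the 1/2 makes the empty product at j = 2 fit.
  Factorial growth is what makes x outgrow every \<open>a ^ j\<close>.\<close>

lemma L_prod_ge_fact: "j \<ge> 2 \<Longrightarrow> L_prod (nth_prime j) \<ge> fact j / 2"
proof (induction j rule: dec_induct)
  case base
  show ?case by (simp add: L_prod_def mid_primes_2)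
next
  case (step j)
  have "fact (Suc j) / 2 = real (Suc j) * (fact j / 2)" by simp
  also have "\<dots> \<le> real (nth_prime (Suc j)) * L_prod (nth_prime j)"
    using step nth_prime_ge[of "Suc j"] by (intro mult_mono) auto
  finally show ?case using step by (simp add: L_prod_Suc)
qed

text \<open>The proportion of residues m modulo the product of these primes for which 6 m - 1 and 6
  m + 1 are both prime to it.\<close>

definition sieve_density :: "nat \<Rightarrow> real" where
  "sieve_density j = (\<Prod>p\<in>mid_primes j. 1 - 2 / real p)"

text \<open>
  The bound on \<open>nth_prime\<close> reduces the claim to a product of factors \<open>(3m - 1) / (3m + 1)\<close>, whose
  cubes dominate the squares of the telescoping factors \<open>(2m - 1) / (2m + 1)\<close>.
\<close>

lemma sieve_density_ge: "j \<ge> 2 \<Longrightarrow> sieve_density j ^ 3 \<ge> 1 / (2 * real j - 3) ^ 2"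
proof (induction j rule: dec_induct)
  case base
  show ?case by (simp add: sieve_density_def mid_primes_2)
next
  case (step j)
  define m where "m = real j - 1"
  define p where "p = real (nth_prime (Suc j))"
  have m: "m \<ge> 1" using step by (simp add: m_def)
  have p: "p \<ge> 3 * m + 1"
  proof -
    have "3 * j \<le> nth_prime (Suc j) + 2" using nth_prime_ge[of "Suc j"] step by simp
    hence "real (3 * j) \<le> real (nth_prime (Suc j) + 2)" by (simp only: of_nat_le_iff)
    thus ?thesis by (simp add: p_def m_def)
  qed
  have "((2 * m - 1) / (2 * m + 1)) ^ 2 \<le> ((3 * m - 1) / (3 * m + 1)) ^ 3"
  proof -
    \<comment> \<open>The difference below is only 10 m^2 - 2, because the higher terms cancel;
      written in n it has nonnegative coefficients.\<close>
    define n where "n = m - 1"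
    have n: "n \<ge> 0" "m = n + 1" using m by (auto simp: n_def)
    have "0 \<le> (3 * m - 1) ^ 3 * (2 * m + 1) ^ 2 - (2 * m - 1) ^ 2 * (3 * m + 1) ^ 3"
      using n(1) unfolding n(2) by (simp add: power2_eq_square power3_eq_cube algebra_simps)
    thus ?thesis using m by (simp add: power_divide divide_simps mult.commute)
  qed
  also have "\<dots> \<le> (1 - 2 / p) ^ 3"
  proof (rule power_mono)
    have "2 / p \<le> 2 / (3 * m + 1)" using p m by (intro divide_left_mono) auto
    thus "(3 * m - 1) / (3 * m + 1) \<le> 1 - 2 / p" using m by (simp add: field_simps)
  qed (use m in auto)
  finally have *: "((2 * m - 1) / (2 * m + 1)) ^ 2 \<le> (1 - 2 / p) ^ 3" .
  have "1 / (2 * real (Suc j) - 3) ^ 2 = ((2 * m - 1) / (2 * m + 1)) ^ 2 * (1 / (2 * real j - 3) ^ 2)"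
  proof -
    have "2 * real (Suc j) - 3 = 2 * m + 1" "2 * real j - 3 = 2 * m - 1" by (auto simp: m_def)
    thus ?thesis using m by (simp add: power_divide)
  qed
  also have "\<dots> \<le> (1 - 2 / p) ^ 3 * sieve_density j ^ 3"
    by (intro mult_mono * step) (use p m in auto)
  also have "(1 - 2 / p) * sieve_density j = sieve_density (Suc j)"
    unfolding sieve_density_def p_def using step mid_primes_Suc[of j] by simp
  hence "(1 - 2 / p) ^ 3 * sieve_density j ^ 3 = sieve_density (Suc j) ^ 3"
    by (metis power_mult_distrib)
  finally show ?case .
qed

text \<open>Every \<open>n \<le> N\<close> is a square at most \<open>N\<close> times one of the squarefree products of primes up to \<open>N\<close>.\<close>

lemma le_4_power_card_primes: "N \<le> 4 ^ card {p::nat. prime p \<and> p \<le> N}"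
proof -
  define P where "P = {p::nat. prime p \<and> p \<le> N}"
  have "finite P" by (simp add: P_def)
  define k where "k = nat \<lfloor>sqrt (real N)\<rfloor>"
  have "{1..N} \<subseteq> (\<lambda>(A, b). \<Prod>A * b ^ 2) ` (Pow P \<times> {1..k})"
  proof
    fix n assume n: "n \<in> {1..N}"
    define a b where "a = squarefree_part n" and "b = square_part n"
    have n_eq: "n = a * b ^ 2" unfolding a_def b_def by (rule squarefree_decompose)
    have "b ^ 2 \<le> n" "a \<le> n" "a > 0" "b > 0" using n n_eq
      by (auto simp: n_eq power2_eq_square)
    have "a = (\<Prod>p\<in>prime_factors a. p ^ multiplicity p a)"
      using \<open>a > 0\<close> by (rule prime_factorization_nat)
    also have "\<dots> = (\<Prod>p\<in>prime_factors a. p ^ 1)"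
      using squarefree_factorial_semiring'[of a] \<open>a > 0\<close> squarefree_squarefree_part[of n]
      by (intro prod.cong refl) (simp add: a_def[symmetric])
    finally have "a = \<Prod>(prime_factors a)" by simp
    have "real b \<le> sqrt (real N)"
      using \<open>b ^ 2 \<le> n\<close> n by (intro real_le_rsqrt) (auto simp flip: of_nat_power)
    hence "b \<in> {1..k}" using \<open>b > 0\<close> by (auto simp: k_def le_nat_floor Suc_leI)
    moreover have "prime_factors a \<in> Pow P"
      using \<open>a \<le> n\<close> \<open>a > 0\<close> n by (auto simp: P_def prime_factors_dvd dest!: dvd_imp_le)
    ultimately show "n \<in> (\<lambda>(A, b). \<Prod>A * b ^ 2) ` (Pow P \<times> {1..k})"
      using n_eq \<open>a = \<Prod>(prime_factors a)\<close> by (intro image_eqI[of _ _ "(prime_factors a, b)"]) auto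
  qed
  hence "card {1..N} \<le> card (Pow P \<times> {1..k})"
    by (rule surj_card_le[rotated]) (use \<open>finite P\<close> in auto)
  hence "real N \<le> real (2 ^ card P * k)"
    by (simp only: of_nat_le_iff card_atLeastAtMost card_cartesian_product card_Pow[OF \<open>finite P\<close>] diff_Suc_1)
  also have "\<dots> = 2 ^ card P * real k" by simp
  also have "real k \<le> sqrt (real N)" by (simp add: k_def)
  finally have "sqrt (real N) * sqrt (real N) \<le> 2 ^ card P * sqrt (real N)" by simp
  hence "sqrt (real N) \<le> 2 ^ card P"
    by (cases "N = 0") (auto simp del: real_sqrt_mult_self)
  hence "sqrt (real N) ^ 2 \<le> (2 ^ card P) ^ 2" by (intro power_mono) auto
  also have "(2 ^ card P) ^ 2 = (4::real) ^ card P" by (simp add: power2_eq_square flip: power_mult_distrib)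
  finally have "real N \<le> real (4 ^ card P)" by simp
  thus ?thesis unfolding P_def by (simp only: of_nat_le_iff)
qed

text \<open>Exactly j primes lie below the next one, so the preceding count applies to N =
  \<open>nth_prime (Suc j) - 1\<close>. An exponential bound is good enough to make
  \<open>M_of (j + 1)\<close> negligible beside the factorial growth of
  \<open>L_prod\<close>.\<close>

lemma nth_prime_Suc_le:
  assumes "j \<ge> 1" shows "nth_prime (Suc j) \<le> 4 ^ j + 1"
proof -
  define N where "N = nth_prime (Suc j) - 1"
  have "N < nth_prime (Suc j)" using prime_gt_0_nat[OF prime_nth_prime, of "Suc j"] by (simp add: N_def)
  moreover have "nth_prime j < nth_prime (Suc j)" using assms by (intro nth_prime_less) auto
  moreover have "p \<le> nth_prime j" if "prime p" "p < nth_prime (Suc j)" for p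
  proof -
    have "p \<in> insert (nth_prime (Suc j)) {p. prime p \<and> p \<le> nth_prime j}"
      unfolding primes_le_nth_prime_Suc[OF assms, symmetric] using that by simp
    thus ?thesis using that by simp
  qed
  ultimately have "{p. prime p \<and> p \<le> N} = {p. prime p \<and> p \<le> nth_prime j}"
    by (auto simp: N_def)
  hence "card {p. prime p \<and> p \<le> N} = j" using card_primes_le_nth_prime[OF assms] by simp
  thus ?thesis using le_4_power_card_primes[of N] by (simp add: N_def)
qed

text \<open>The factorial beats \<open>2 * b ^ j\<close>, and the subtracted
  \<open>M_of (j + 1)\<close> costs at most one \<open>b ^ j\<close>.\<close>

lemma eventually_x_of_ge:
  fixes a :: real
  assumes "a \<ge> 1"
  shows "eventually (\<lambda>j. x_of j \<ge> a ^ j \<and> x_of j \<le> L_prod (nth_prime j)) at_top"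
proof -
  \<comment> \<open>16 is the square of the 4 in the bound for the next prime.\<close>
  define b where "b = max a 16"
  have "(\<lambda>j. b ^ j / fact j) \<longlonglongrightarrow> 0"
    using summable_LIMSEQ_zero[OF summable_exp[of b]] by (simp add: field_simps)
  hence "eventually (\<lambda>j. b ^ j / fact j < 1 / 4) at_top"
    by (rule order_tendstoD) auto
  thus ?thesis using eventually_ge_at_top[of 2]
  proof eventually_elim
    case (elim j)
    have L: "L_prod (nth_prime j) \<ge> 2 * b ^ j"
      using L_prod_ge_fact[of j] elim by (simp add: field_simps)
    have "real (nth_prime (j + 1)) \<le> 2 * 4 ^ j"
    proof -
      have "nth_prime (j + 1) \<le> 2 * 4 ^ j"
        using nth_prime_Suc_le[of j] elim by (simp add: order_trans)
      hence "real (nth_prime (j + 1)) \<le> real (2 * 4 ^ j)" by (simp only: of_nat_le_iff)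
      thus ?thesis by simp
    qed
    hence "real (nth_prime (j + 1)) ^ 2 \<le> (2 * 4 ^ j) ^ 2" by (intro power_mono) auto
    also have "\<dots> = 4 * 16 ^ j" by (simp add: power_mult_distrib power2_eq_square flip: power_mult_distrib)
    also have "(16::real) ^ j \<le> b ^ j" by (intro power_mono) (auto simp: b_def)
    finally have "real (nth_prime (j + 1)) ^ 2 \<le> 4 * b ^ j" by simp
    moreover have "b ^ j \<ge> 0" by (simp add: b_def)
    ultimately have "M_of (j + 1) \<le> b ^ j" unfolding M_of_def by (simp add: mult.commute)
    moreover have "a ^ j \<le> b ^ j" using assms by (intro power_mono) (auto simp: b_def)
    moreover have "M_of (j + 1) \<ge> 0" using prime_gt_0_nat[OF prime_nth_prime, of "j + 1"] unfolding M_of_def by simp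
    ultimately show ?case using L unfolding x_of_def by linarith
  qed
qed

lemma R0_ge:
  assumes "j \<ge> 2" "0 < x_of j" "x_of j \<le> L_prod (nth_prime j)"
  shows "R0 j \<ge> x_of j / (2 * real j) powr (2 / 3)"
proof -
  have nonneg: "sieve_density j \<ge> 0" unfolding sieve_density_def
    by (intro prod_nonneg) (auto simp: field_simps)
  have "(1 / (2 * real j) powr (2 / 3)) ^ 3 = 1 / (2 * real j) ^ 2"
    using assms by (simp add: power_divide powr_power powr_numeral)
  also have "\<dots> \<le> 1 / (2 * real j - 3) ^ 2"
    using assms by (intro divide_left_mono power_mono) auto
  also have "\<dots> \<le> sieve_density j ^ 3" by (rule sieve_density_ge) fact
  finally have "1 / (2 * real j) powr (2 / 3) \<le> sieve_density j"
    using nonneg by (subst (asm) power_mono_iff) auto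
  hence "x_of j * (1 / (2 * real j) powr (2 / 3)) \<le> L_prod (nth_prime j) * sieve_density j"
    using assms by (intro mult_mono) auto
  thus ?thesis unfolding R0_def sieve_density_def by simp
qed

subsection \<open>Chebyshev's upper bound\<close>

text \<open>The coefficient occurs twice in a row of sum \<open>2 * 4 ^ m\<close>.\<close>

lemma binomial_odd_le: "(2 * m + 1) choose m \<le> 4 ^ m"
proof -
  have "((2 * m + 1) choose m) + ((2 * m + 1) choose (m + 1)) = (\<Sum>k\<in>{m, m + 1}. (2 * m + 1) choose k)"
    by simp
  also have "\<dots> \<le> (\<Sum>k\<le>2 * m + 1. (2 * m + 1) choose k)"
    by (intro sum_mono2) auto
  also have "\<dots> = 2 * 4 ^ m" by (simp only: choose_row_sum) (simp add: power_mult)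
  also have "(2 * m + 1) choose (m + 1) = (2 * m + 1) choose m"
    by (subst binomial_symmetric) auto
  finally show ?thesis by simp
qed

lemma prod_primes_dvd:
  assumes "finite A" "\<And>p. p \<in> A \<Longrightarrow> prime (p::nat)" "\<And>p. p \<in> A \<Longrightarrow> p dvd n"
  shows "\<Prod>A dvd n"
  using assms
proof (induction A rule: finite_induct)
  case (insert p A)
  have "coprime p (\<Prod>A)"
    using insert by (intro prod_coprime_right primes_coprime) auto
  thus ?case using insert by (auto intro: divides_mult)
qed auto

text \<open>Erdos's induction: an even n > 2 adds no prime, and for n = 2 m + 1 the primes above m +
  1 all divide \<open>n choose m\<close>, which is at most \<open>4 ^ m\<close>.\<close>

lemma primorial_le: "(\<Prod>p | prime p \<and> p \<le> n. p) \<le> (4::nat) ^ n"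
proof (induction n rule: less_induct)
  case (less n)
  consider "n \<le> 2" | "n > 2" "even n" | "n > 2" "odd n" by linarith
  thus ?case
  proof cases
    case 1
    hence "{p. prime p \<and> p \<le> n} = (if n = 2 then {2} else {})"
      by (auto dest: prime_ge_2_nat)
    thus ?thesis by simp
  next
    case 2
    hence "\<not> prime n" using prime_odd_nat by blast
    hence "{p. prime p \<and> p \<le> n} = {p. prime p \<and> p \<le> n - 1}"
      by (intro Collect_cong) (use 2 in \<open>auto simp: le_less\<close>)
    hence "(\<Prod>p | prime p \<and> p \<le> n. p) \<le> 4 ^ (n - 1)" using less[of "n - 1"] 2 by simp
    also have "\<dots> \<le> 4 ^ n" by (intro power_increasing) auto
    finally show ?thesis .
  next
    assume n: "n > 2" "odd n"
    define m where "m = n div 2"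
    have 3: "n = 2 * m + 1" "m \<ge> 1" using n by (auto simp: m_def)
    define Q where "Q = {p. prime p \<and> m + 1 < p \<and> p \<le> n}"
    have "{p. prime p \<and> p \<le> n} = {p. prime p \<and> p \<le> m + 1} \<union> Q"
      using 3 by (auto simp: Q_def)
    hence "(\<Prod>p | prime p \<and> p \<le> n. p) = (\<Prod>p | prime p \<and> p \<le> m + 1. p) * \<Prod>Q"
      by (simp, subst prod.union_disjoint) (auto simp: Q_def)
    also have "\<dots> \<le> 4 ^ (m + 1) * 4 ^ m"
    proof (rule mult_mono)
      show "(\<Prod>p | prime p \<and> p \<le> m + 1. p) \<le> 4 ^ (m + 1)" using 3 by (intro less) auto
      have "\<Prod>Q dvd n choose m"
      proof (rule prod_primes_dvd)
        fix p assume p: "p \<in> Q"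
        have "p dvd fact n" using p by (auto simp: Q_def prime_dvd_fact_iff)
        also have "fact n = fact m * fact (n - m) * (n choose m)"
          using 3 by (subst binomial_fact_lemma) auto
        finally have "p dvd fact m * fact (n - m) * (n choose m)" .
        moreover have "prime p" "\<not> p dvd fact m" "\<not> p dvd fact (n - m)"
          using p 3 by (auto simp only: Q_def mem_Collect_eq prime_dvd_fact_iff)
        ultimately show "p dvd n choose m" by (simp only: prime_dvd_mult_iff) blast
      qed (auto simp: Q_def)
      hence "\<Prod>Q \<le> n choose m" using 3 by (intro dvd_imp_le) auto
      also have "\<dots> \<le> 4 ^ m" using binomial_odd_le 3 by simp
      finally show "\<Prod>Q \<le> 4 ^ m" .
    qed auto
    also have "\<dots> = 4 ^ n" using 3 by (simp flip: power_add add: mult_2)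
    finally show ?thesis .
  qed
qed

text \<open>Primes up to \<open>sqrt n\<close> are counted trivially; each larger one contributes a
  factor above \<open>sqrt n\<close> to the primorial, so their number is at most 2 n ln 4 / ln n,
  and ln 4 <= 2.\<close>

lemma card_primes_le:
  fixes n :: nat
  assumes "n \<ge> 2"
  shows "real (card {p. prime p \<and> p \<le> n}) \<le> sqrt n + 4 * n / ln n"
proof -
  define A where "A = {p. prime p \<and> p \<le> n}"
  define B where "B = {p. prime p \<and> sqrt n < p \<and> p \<le> n}"
  define k where "k = nat \<lfloor>sqrt (real n)\<rfloor>"
  have fin: "finite A" "finite B" by (auto simp: A_def B_def)
  have ln: "ln n > 0" using assms by simp
  have "A \<subseteq> {1..k} \<union> B"
  proof
    fix p assume "p \<in> A"
    moreover have "p \<le> k" if "real p \<le> sqrt n" using that by (simp add: k_def le_nat_floor)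
    ultimately show "p \<in> {1..k} \<union> B"
      by (auto simp: A_def B_def not_less prime_gt_0_nat Suc_leI)
  qed
  hence "card A \<le> card ({1..k} \<union> B)" using fin by (intro card_mono) auto
  also have "\<dots> \<le> k + card B" using card_Un_le[of "{1..k}" B] by simp
  finally have "real (card A) \<le> real k + real (card B)" by linarith
  moreover have "real k \<le> sqrt n" by (simp add: k_def)
  moreover have "real (card B) \<le> 4 * n / ln n"
  proof -
    have "sqrt n ^ card B = (\<Prod>p\<in>B. sqrt n)" by simp
    also have "\<dots> \<le> (\<Prod>p\<in>B. real p)" by (intro prod_mono) (auto simp: B_def)
    also have "\<dots> \<le> (\<Prod>p\<in>A. real p)"
      using fin by (intro prod_mono2) (auto simp: A_def B_def prime_gt_0_nat Suc_leI)
    also have "\<dots> = real (\<Prod>A)" by simp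
    also have "\<dots> \<le> real (4 ^ n)" using primorial_le[of n] by (simp only: A_def of_nat_le_iff)
    also have "\<dots> = 4 ^ n" by simp
    finally have "ln (sqrt n ^ card B) \<le> ln (4 ^ n)" using assms by (subst ln_le_cancel_iff) auto
    hence "card B * ln n \<le> 2 * n * ln 4" using assms by (simp add: ln_realpow ln_sqrt field_simps)
    also have "ln 4 \<le> (2::real)" using ln_le_minus_one[of 2] ln_realpow[of 2 2] by simp
    hence "2 * n * ln 4 \<le> 2 * n * (2::real)" using assms by (intro mult_left_mono) auto
    finally show ?thesis using ln by (simp add: field_simps)
  qed
  ultimately show ?thesis by (simp add: A_def)
qed

text \<open>Only the primality of 6 m + 1 enters. One logarithm saved is enough against a main term
  short of x by only its 2/3 power.\<close>

lemma twin_pi_le: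
  assumes x: "x \<ge> 1"
  shows "real (twin_pi (6 * x + 1)) \<le> sqrt (6 * x + 1) + 4 * (6 * x + 1) / ln (6 * x)"
proof -
  define n where "n = nat \<lfloor>6 * x + 1\<rfloor>"
  have n: "real n \<le> 6 * x + 1" "real n > 6 * x" using x by (auto simp: n_def)
  have *: "6 * m + 1 \<le> n" if "real (6 * m + 1) < 6 * x + 1" for m
    unfolding n_def using that by (intro le_nat_floor) linarith
  have "twin_pi (6 * x + 1) \<le> card {p. prime p \<and> p \<le> n}"
    unfolding twin_pi_def
  proof (rule card_inj_on_le)
    show "inj_on (\<lambda>m. 6 * m + 1) {m. 1 \<le> m \<and> prime (6 * m - 1) \<and> prime (6 * m + 1) \<and> real (6 * m + 1) < 6 * x + 1}"
      by (auto intro: inj_onI)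
    show "(\<lambda>m. 6 * m + 1) ` {m. 1 \<le> m \<and> prime (6 * m - 1) \<and> prime (6 * m + 1) \<and> real (6 * m + 1) < 6 * x + 1} \<subseteq> {p. prime p \<and> p \<le> n}"
      using * by auto
  qed auto
  hence "real (twin_pi (6 * x + 1)) \<le> sqrt n + 4 * n / ln n"
    using card_primes_le[of n] n x by linarith
  also have "\<dots> \<le> sqrt (6 * x + 1) + 4 * (6 * x + 1) / ln (6 * x)"
    using n x by (intro add_mono frac_le real_sqrt_le_mono) auto
  finally show ?thesis .
qed

section \<open>The zeta function\<close>

text \<open>Telescoping gives the identity for Re s > 1, and analytic continuation carries it over,
  since the series is holomorphic on the punctured half-plane. This makes zeta explicit, hence
  estimable, left of the line Re s = 1.\<close>

lemma sums_zeta_term: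
  assumes s: "Re s > 0" "s \<noteq> 1"
  shows "(\<lambda>n. zeta_term n s) sums (zeta s - 1 / (s - 1))"
proof -
  define S where "S = {s. Re s > 0} - {1::complex}"
  have oS: "open S"
    unfolding S_def by (intro open_delete open_halfspace_Re_gt)
  obtain g where g: "\<And>s. s \<in> S \<Longrightarrow> (\<lambda>n. zeta_term n s) sums g s"
    "\<And>s. s \<in> S \<Longrightarrow> g field_differentiable (at s)"
  proof (rule series_differentiable_comparison_complex[OF oS, of zeta_term])
    fix n s assume "s \<in> S"
    have "zeta_term n holomorphic_on S"
      unfolding zeta_term_def by (intro holomorphic_intros) (auto simp: S_def)
    thus "zeta_term n field_differentiable (at s)"
      using oS \<open>s \<in> S\<close> by (simp add: holomorphic_on_imp_differentiable_at)
  next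
    fix s assume s: "s \<in> S"
    define d where "d = Re s / 2"
    define h where "h = (\<lambda>n. complex_of_real ((cmod s + d) * real (Suc n) powr (- d - 1)))"
    have d: "d > 0" using s by (simp add: d_def S_def)
    have "summable h"
      unfolding h_def using d by (intro summable_of_real summable_mult summable_Suc_powr) auto
    moreover have "range h \<subseteq> \<real>\<^sub>\<ge>\<^sub>0"
      using d unfolding h_def image_subset_iff
      by (auto simp: nonneg_Reals_of_real_iff simp del: of_real_mult of_real_add of_nat_Suc)
    moreover have "cmod (zeta_term n y) \<le> cmod (h n)" if y: "y \<in> ball s d \<inter> S" for n y
    proof -
      have dist: "cmod (y - s) < d" using y by (simp add: dist_norm norm_minus_commute)
      have re: "Re y \<ge> d" using dist abs_Re_le_cmod[of "y - s"] by (simp add: d_def)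
      have nm: "cmod y \<le> cmod s + d" using dist norm_triangle_ineq2[of y s] by linarith
      have "cmod (zeta_term n y) \<le> cmod y * real (Suc n) powr (- Re y - 1)"
        using y by (intro norm_zeta_term_le) (auto simp: S_def)
      also have "\<dots> \<le> (cmod s + d) * real (Suc n) powr (- d - 1)"
        using re nm d by (intro mult_mono powr_mono) auto
      finally show ?thesis
        unfolding h_def norm_of_real using d by (simp add: abs_mult)
    qed
    ultimately show "\<exists>d h. 0 < d \<and> summable h \<and> range h \<subseteq> \<real>\<^sub>\<ge>\<^sub>0 \<and>
        (\<forall>\<^sub>F n in sequentially. \<forall>y\<in>ball s d \<inter> S. cmod (zeta_term n y) \<le> cmod (h n))"
      using d by (intro exI[of _ d] exI[of _ h] conjI always_eventually allI ballI)
  qed blast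
  have "g s = zeta s - 1 / (s - 1)"
  proof (rule analytic_continuation_open[of "{s. Re s > 1}" S g "\<lambda>s. zeta s - 1 / (s - 1)"])
    show "g z = zeta z - 1 / (z - 1)" if "z \<in> {s. Re s > 1}" for z
    proof -
      have z: "Re z > 1" using that by simp
      have "(\<lambda>n. of_nat (Suc n) powr (1 - z) :: complex) \<longlonglongrightarrow> 0"
        using z by (intro tendsto_neg_powr_complex_of_nat filterlim_Suc) auto
      from sums_divide[OF telescope_sums[OF this], of "1 - z"]
      have "(\<lambda>n. (of_nat (Suc (Suc n)) powr (1 - z) - of_nat (Suc n) powr (1 - z)) / (1 - z))
          sums (1 / (z - 1))"
        using minus_divide_divide[of 1 "z - 1"] by simp
      moreover have "(\<lambda>n. of_nat (Suc n) powr (-z)) sums zeta z"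
        using z is_zeta_zeta unfolding is_zeta_def by blast
      ultimately have "(\<lambda>n. zeta_term n z) sums (zeta z - 1 / (z - 1))"
        unfolding zeta_term_def by (intro sums_diff)
      moreover have "(\<lambda>n. zeta_term n z) sums g z"
        using z by (intro g(1)) (auto simp: S_def)
      ultimately show ?thesis by (rule sums_unique2[symmetric])
    qed
    show "connected S" unfolding S_def
      by (intro connected_open_delete open_halfspace_Re_gt convex_connected convex_halfspace_Re_gt) auto
    show "{s. Re s > 1} \<noteq> {}" by (auto intro!: exI[of _ 2])
    show "g holomorphic_on S"
      using g(2) oS by (simp add: holomorphic_on_def field_differentiable_at_within)
    show "(\<lambda>s. zeta s - 1 / (s - 1)) holomorphic_on S"
      using is_zeta_zeta unfolding is_zeta_def S_def by (intro holomorphic_intros) auto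
  qed (use s oS in \<open>auto simp: S_def open_halfspace_Re_gt\<close>)
  thus ?thesis using g(1)[of s] s by (simp add: S_def)
qed

text \<open>Serves twice: near 1 it shows that the pole is simple with residue 1, and high up it
  bounds zeta linearly in the height.\<close>

lemma norm_zeta_diff_pole_le:
  assumes "a > 0" "Re s \<ge> a" "s \<noteq> 1"
  shows "cmod (zeta s - 1 / (s - 1)) \<le> cmod s * (\<Sum>n. real (Suc n) powr (- a - 1))"
proof -
  have sm: "(\<lambda>n. cmod s * real (Suc n) powr (- a - 1)) sums (cmod s * (\<Sum>n. real (Suc n) powr (- a - 1)))"
    using assms by (intro sums_mult summable_sums summable_Suc_powr) auto
  have "cmod (\<Sum>n. zeta_term n s) \<le> (\<Sum>n. cmod s * real (Suc n) powr (- a - 1))"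
  proof (rule norm_suminf_le)
    fix n
    have "cmod (zeta_term n s) \<le> cmod s * real (Suc n) powr (- Re s - 1)"
      using assms by (intro norm_zeta_term_le) auto
    also have "\<dots> \<le> cmod s * real (Suc n) powr (- a - 1)"
      using assms by (intro mult_left_mono powr_mono) auto
    finally show "cmod (zeta_term n s) \<le> cmod s * real (Suc n) powr (- a - 1)" .
  qed (use sm in \<open>auto simp: sums_iff\<close>)
  thus ?thesis using sums_unique[OF sums_zeta_term[of s]] assms sums_unique[OF sm] by simp
qed

text \<open>The removable singularity is filled with the residue by hand, as \<open>zeta 1\<close>
  is unspecified and \<open>(s - 1) * zeta s\<close> would be 0 there.\<close>

definition zeta_reg :: "complex \<Rightarrow> complex" where
  "zeta_reg s = (if s = 1 then 1 else (s - 1) * zeta s)"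

lemma zeta_reg_tendsto_1: "(zeta_reg \<longlongrightarrow> 1) (at 1)"
proof -
  define K where "K = (\<Sum>n. real (Suc n) powr (- (1 / 2) - 1))"
  have "((\<lambda>s. zeta_reg s - 1) \<longlongrightarrow> 0) (at 1)"
  proof (rule tendsto_0_le[where f = "\<lambda>s. (s - 1) * s" and K = "\<bar>K\<bar>"])
    show "((\<lambda>s::complex. (s - 1) * s) \<longlongrightarrow> 0) (at 1)"
      by (auto intro!: tendsto_eq_intros)
    have "eventually (\<lambda>s. s \<in> {s. Re s > 1 / 2}) (nhds (1::complex))"
      by (rule eventually_nhds_in_open[OF open_halfspace_Re_gt]) simp
    hence "eventually (\<lambda>s::complex. Re s > 1 / 2) (at 1)"
      by (simp add: eventually_at_filter eventually_mono)
    moreover have "eventually (\<lambda>s::complex. s \<noteq> 1) (at 1)"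
      by (rule eventually_neq_at_within)
    ultimately show "eventually (\<lambda>s. norm (zeta_reg s - 1) \<le> norm ((s - 1) * s) * \<bar>K\<bar>) (at 1)"
    proof eventually_elim
      case (elim s)
      have "zeta_reg s - 1 = (s - 1) * (zeta s - 1 / (s - 1))"
        using elim by (simp add: zeta_reg_def field_simps)
      also have "cmod \<dots> \<le> cmod (s - 1) * (cmod s * K)"
        unfolding norm_mult K_def
        using elim by (intro mult_left_mono norm_zeta_diff_pole_le) auto
      also have "\<dots> \<le> cmod (s - 1) * (cmod s * \<bar>K\<bar>)"
        by (intro mult_left_mono) auto
      finally show ?case by (simp add: norm_mult mult.assoc)
    qed
  qed
  thus ?thesis by (simp add: LIM_zero_iff)
qed

lemma holomorphic_zeta_reg: "zeta_reg holomorphic_on {s. Re s > 0}"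
proof (rule no_isolated_singularity'[of "{1}"])
  show "(zeta_reg \<longlongrightarrow> zeta_reg z) (at z within {s. Re s > 0})" if "z \<in> {1}" for z
    using that zeta_reg_tendsto_1 by (auto simp: zeta_reg_def intro: tendsto_within_subset)
  have "zeta holomorphic_on {s. Re s > 0} - {1}"
    using is_zeta_zeta by (simp add: is_zeta_def)
  hence "(\<lambda>s. (s - 1) * zeta s) holomorphic_on {s. Re s > 0} - {1}"
    by (intro holomorphic_intros)
  thus "zeta_reg holomorphic_on {s. Re s > 0} - {1}"
    by (rule holomorphic_transform) (auto simp: zeta_reg_def)
qed (auto simp: open_halfspace_Re_gt)

subsection \<open>The Euler product\<close>

lemma summable_norm_powr:
  assumes "Re s > 1"
  shows "summable (\<lambda>n. norm (of_nat (Suc n) powr (-s) :: complex))"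
proof -
  have "norm (of_nat (Suc n) powr (-s) :: complex) = real (Suc n) powr (- Re s)" for n
    using norm_powr_real_powr[of "of_nat (Suc n)" "-s"] by simp
  thus ?thesis using summable_Suc_powr[of "- Re s"] assms by simp
qed

lemma range_Suc: "range Suc = {1..}"
  by (auto simp: image_iff) (metis Suc_le_D)

lemma has_sum_zeta:
  assumes "Re s > 1"
  shows "((\<lambda>n. of_nat n powr (-s)) has_sum zeta s) {1..}"
proof -
  have "((\<lambda>n. of_nat (Suc n) powr (-s)) has_sum zeta s) UNIV"
    using is_zeta_zeta assms
    by (intro norm_summable_imp_has_sum summable_norm_powr) (auto simp: is_zeta_def)
  thus ?thesis
    unfolding range_Suc[symmetric] using has_sum_reindex[of Suc UNIV "\<lambda>n. of_nat n powr (-s)" "zeta s"] by (simp add: o_def)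
qed

definition euler_prod :: "nat \<Rightarrow> complex \<Rightarrow> complex" where
  "euler_prod N s = (\<Prod>p | prime p \<and> p \<le> N. 1 - of_nat p powr (-s))"

text \<open>Sieve of Eratosthenes on the Dirichlet series: multiplying by one more factor subtracts
  exactly the terms at the multiples of p. Unordered sums allow this removal without regard to
  order.\<close>

lemma has_sum_zeta_sieved:
  assumes s: "Re s > 1" and A: "finite A" "\<And>p. p \<in> A \<Longrightarrow> prime p"
  shows "((\<lambda>n. of_nat n powr (-s)) has_sum (zeta s * (\<Prod>p\<in>A. 1 - of_nat p powr (-s))))
           {n::nat. n \<ge> 1 \<and> (\<forall>p\<in>A. \<not> p dvd n)}"
  using A
proof (induction A rule: finite_induct)
  case empty
  thus ?case using has_sum_zeta[OF s] by (simp add: atLeast_def)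
next
  case (insert p A)
  define X where "X = {n::nat. n \<ge> 1 \<and> (\<forall>p\<in>A. \<not> p dvd n)}"
  define a where "a = zeta s * (\<Prod>p\<in>A. 1 - of_nat p powr (-s))"
  have IH: "((\<lambda>n. of_nat n powr (-s)) has_sum a) X"
    using insert unfolding X_def a_def by auto
  have p: "prime p" using insert by auto
  hence p0: "p > 0" by (rule prime_gt_0_nat)
  have "((\<lambda>n. of_nat p powr (-s) * of_nat n powr (-s)) has_sum (of_nat p powr (-s) * a)) X"
    by (intro has_sum_cmult_right IH)
  also have "(\<lambda>n. of_nat p powr (-s) * of_nat n powr (-s)) = (\<lambda>n. of_nat n powr (-s) :: complex) \<circ> (\<lambda>n. p * n)"
    by (simp add: fun_eq_iff powr_times_real)
  finally have *: "((\<lambda>n. of_nat n powr (-s)) \<circ> (\<lambda>n. p * n) has_sum (of_nat p powr (-s) * a)) X" .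
  have "inj_on (\<lambda>n. p * n) X" using p0 by (auto intro: inj_onI)
  hence "((\<lambda>n. of_nat n powr (-s)) has_sum (of_nat p powr (-s) * a)) ((\<lambda>n. p * n) ` X)"
    using * by (simp only: has_sum_reindex)
  moreover have "\<not> q dvd p" if "q \<in> A" for q
    using that insert.prems insert.hyps p primes_dvd_imp_eq[of q p] by auto
  hence "(\<lambda>n. p * n) ` X \<subseteq> X"
    using insert.prems insert.hyps p p0 by (auto simp: X_def prime_dvd_mult_iff Suc_leI dest: primes_dvd_imp_eq)
  ultimately have "((\<lambda>n. of_nat n powr (-s)) has_sum (a - of_nat p powr (-s) * a)) (X - (\<lambda>n. p * n) ` X)"
    by (intro has_sum_Diff IH)
  also have "X - (\<lambda>n. p * n) ` X = {n. n \<ge> 1 \<and> (\<forall>q\<in>insert p A. \<not> q dvd n)}"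
  proof -
    have "n \<in> (\<lambda>n. p * n) ` X" if n: "n \<in> X" "p dvd n" for n
    proof -
      obtain k where k: "n = p * k" using n(2) unfolding dvd_def by blast
      hence "k \<in> X" using n by (auto simp: X_def)
      thus ?thesis using k by blast
    qed
    thus ?thesis by (auto simp: X_def)
  qed
  also have "a - of_nat p powr (-s) * a = zeta s * (\<Prod>q\<in>insert p A. 1 - of_nat q powr (-s))"
    using insert by (simp add: a_def algebra_simps)
  finally show ?case .
qed

text \<open>After sieving by the primes up to N, every remaining n except 1 exceeds N, so the
  deviation from 1 is at most a tail of the absolutely convergent series. In this product form, zeta
  cannot vanish.\<close>

lemma euler_prod_tendsto:
  assumes s: "Re s > 1"
  shows "(\<lambda>N. zeta s * euler_prod N s) \<longlonglongrightarrow> 1"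
proof -
  define f where "f = (\<lambda>n::nat. of_nat n powr (-s) :: complex)"
  have abs: "(\<lambda>n. norm (f n)) summable_on {1..}"
  proof -
    have "(\<lambda>n. norm (f (Suc n))) summable_on UNIV"
      using summable_norm_powr[OF s] unfolding f_def by (intro norm_summable_imp_summable_on) auto
    thus ?thesis unfolding range_Suc[symmetric] using summable_on_reindex[of Suc UNIV "\<lambda>n. norm (f n)"] by (simp add: o_def)
  qed
  define Z where "Z = infsum (\<lambda>n. norm (f n)) {1..}"
  have "norm (zeta s * euler_prod N s - 1) \<le> Z - (\<Sum>n\<in>{1..N}. norm (f n))" if "N \<ge> 1" for N
  proof -
    define X where "X = {n::nat. n \<ge> 1 \<and> (\<forall>p\<in>{p. prime p \<and> p \<le> N}. \<not> p dvd n)}"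
    have "(f has_sum (zeta s * euler_prod N s)) X"
      unfolding f_def X_def euler_prod_def by (rule has_sum_zeta_sieved[OF s]) auto
    moreover have "(f has_sum 1) {1}" using has_sum_finite[of "{1}" f] by (simp add: f_def)
    moreover have "{1} \<subseteq> X" by (auto simp: X_def)
    ultimately have 1: "(f has_sum (zeta s * euler_prod N s - 1)) (X - {1})"
      by (rule has_sum_Diff)
    have "n > N" if "n \<in> X - {1}" for n
    proof (rule ccontr)
      assume n: "\<not> n > N"
      have "n \<noteq> 1" using that by simp
      then obtain p where p: "prime p" "p dvd n" using prime_factor_nat by blast
      have "p \<le> N" using p n that dvd_imp_le[of p n] by (auto simp: X_def)
      thus False using p that by (auto simp: X_def)
    qed
    hence sub: "X - {1} \<subseteq> {1..} - {1..N}" unfolding X_def by (intro subsetI) fastforce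
    have 2: "((\<lambda>n. norm (f n)) has_sum (Z - (\<Sum>n\<in>{1..N}. norm (f n)))) ({1..} - {1..N})"
      unfolding Z_def by (intro has_sum_Diff has_sum_infsum abs has_sum_finite) auto
    have 3: "(\<lambda>n. norm (f n)) summable_on (X - {1})"
      by (rule summable_on_subset_banach[OF abs]) (auto simp: X_def)
    have "norm (infsum f (X - {1})) \<le> infsum (\<lambda>n. norm (f n)) (X - {1})"
      by (rule norm_infsum_bound) (use 3 in auto)
    also have "\<dots> \<le> infsum (\<lambda>n. norm (f n)) ({1..} - {1..N})"
      by (rule infsum_mono2) (use 2 3 sub in \<open>auto simp: summable_on_def\<close>)
    finally show ?thesis using infsumI[OF 1] infsumI[OF 2] by simp
  qed
  hence bound: "eventually (\<lambda>N. norm (zeta s * euler_prod N s - 1) \<le> Z - (\<Sum>n\<in>{1..N}. norm (f n))) sequentially"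
    by (rule eventually_mono[OF eventually_ge_at_top[of 1]])
  have "((\<lambda>n. norm (f (Suc n))) has_sum Z) UNIV"
  proof -
    have "((\<lambda>n. norm (f n)) has_sum Z) (range Suc)"
      using has_sum_infsum[OF abs] by (simp add: Z_def range_Suc)
    thus ?thesis by (subst (asm) has_sum_reindex) (auto simp: o_def)
  qed
  hence "(\<lambda>N. \<Sum>n\<in>{1..N}. norm (f n)) \<longlonglongrightarrow> Z"
    by (auto dest!: has_sum_imp_sums simp: sums_def sum.atLeast1_atMost_eq)
  hence "(\<lambda>N. Z - (\<Sum>n\<in>{1..N}. norm (f n))) \<longlonglongrightarrow> Z - Z"
    by (intro tendsto_intros)
  hence "(\<lambda>N. zeta s * euler_prod N s - 1) \<longlonglongrightarrow> 0"
    by (intro Lim_null_comparison[OF bound]) simp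
  thus ?thesis by (simp add: LIM_zero_iff)
qed

lemma zeta_nonzero_Re_gt_1: "Re s > 1 \<Longrightarrow> zeta s \<noteq> 0"
  using euler_prod_tendsto[of s] by (auto simp: LIMSEQ_const_iff)

subsection \<open>No zeros on the line \<open>Re s = 1\<close>\<close>

text \<open>
  With \<open>q = 1 + r\<^sup>2\<close>, the squares of the three norms are \<open>q (1 - a)\<close>, \<open>q (1 - b)\<close>, \<open>q (1 - d)\<close> with
  \<open>3 a + 4 b + d\<close> a nonnegative multiple of \<open>(1 + Re z)\<^sup>2\<close>.
\<close>

lemma three_four_one_local:
  fixes r :: real and z :: complex
  assumes r: "r \<ge> 0" and z: "cmod z = 1"
  shows "cmod (1 - of_real r) ^ 3 * cmod (1 - of_real r * z) ^ 4 * cmod (1 - of_real r * z ^ 2) \<le> (1 + r ^ 2) ^ 4"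
proof -
  define c where "c = Re z"
  define q where "q = 1 + r ^ 2"
  have q: "q > 0" unfolding q_def by (simp add: add_pos_nonneg)
  have sq: "cmod (1 - of_real r * w) ^ 2 = q * (1 - 2 * r * Re w / q)" if "cmod w = 1" for w
  proof -
    have *: "Re w ^ 2 + Im w ^ 2 = 1" using that by (metis cmod_power2 one_power2)
    have "cmod (1 - of_real r * w) ^ 2 = (1 - r * Re w) ^ 2 + (r * Im w) ^ 2"
      by (simp add: cmod_power2)
    also have "\<dots> = 1 - 2 * r * Re w + r ^ 2 * (Re w ^ 2 + Im w ^ 2)"
      by (simp add: power2_eq_square algebra_simps)
    also have "\<dots> = q - 2 * r * Re w" unfolding * q_def by simp
    also have "\<dots> = q * (1 - 2 * r * Re w / q)" using q by (simp add: field_simps)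
    finally show ?thesis .
  qed
  define a b d where "a = 2 * r / q" and "b = 2 * r * c / q" and "d = 2 * r * (2 * c ^ 2 - 1) / q"
  have "Re (z ^ 2) = 2 * c ^ 2 - 1"
  proof -
    have "c ^ 2 + Im z ^ 2 = 1" using z unfolding c_def by (metis cmod_power2 one_power2)
    thus ?thesis by (simp add: c_def power2_eq_square)
  qed
  hence A: "cmod (1 - of_real r) ^ 2 = q * (1 - a)" "cmod (1 - of_real r * z) ^ 2 = q * (1 - b)"
    "cmod (1 - of_real r * z ^ 2) ^ 2 = q * (1 - d)"
    using sq[of 1] sq[of z] sq[of "z ^ 2"] z by (auto simp: a_def b_def d_def c_def norm_power)
  have nn: "1 - a \<ge> 0" "1 - b \<ge> 0" "1 - d \<ge> 0"
    using A q by (metis zero_le_mult_iff zero_le_power2 not_le order_less_imp_le)+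
  have le: "1 - u \<le> exp (- u)" for u :: real using exp_ge_add_one_self[of "-u"] by simp
  have "(1 - a) ^ 3 * (1 - b) ^ 4 * (1 - d) \<le> exp (- a) ^ 3 * exp (- b) ^ 4 * exp (- d)"
    using nn le by (intro mult_mono power_mono) auto
  also have "\<dots> = exp (- (3 * a + 4 * b + d))"
    by (simp flip: exp_add exp_of_nat_mult)
  also have "\<dots> \<le> 1"
  proof -
    have "3 * a + 4 * b + d = 4 * r * (1 + c) ^ 2 / q"
      unfolding a_def b_def d_def by (simp add: power2_eq_square algebra_simps flip: add_divide_distrib)
    thus ?thesis using q r by simp
  qed
  finally have *: "(1 - a) ^ 3 * (1 - b) ^ 4 * (1 - d) \<le> 1" .
  have "(cmod (1 - of_real r) ^ 3 * cmod (1 - of_real r * z) ^ 4 * cmod (1 - of_real r * z ^ 2)) ^ 2 =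
        (cmod (1 - of_real r) ^ 2) ^ 3 * (cmod (1 - of_real r * z) ^ 2) ^ 4 * cmod (1 - of_real r * z ^ 2) ^ 2"
    by (simp add: power_mult_distrib flip: power_mult)
  also have "\<dots> = q ^ 8 * ((1 - a) ^ 3 * (1 - b) ^ 4 * (1 - d))"
    unfolding A by (simp add: power_mult_distrib power_numeral_reduce)
  also have "\<dots> \<le> q ^ 8 * 1" using * q by (intro mult_left_mono) auto
  also have "\<dots> = (q ^ 4) ^ 2" by (simp flip: power_mult)
  finally show ?thesis unfolding q_def by (rule power2_le_imp_le) (use q in \<open>auto simp: q_def\<close>)
qed

text \<open>Mertens's inequality with a worse constant than the classical 1: the local losses
  \<open>(1 + r ^ 2) ^ 4\<close> multiply up to a bound independent of \<sigma> and t, which avoids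
  logarithms of Euler factors.\<close>

lemma three_four_one:
  assumes \<sigma>: "\<sigma> > 1"
  shows "1 \<le> exp (4 * (\<Sum>n. real (Suc n) powr (-2))) *
    (cmod (zeta (of_real \<sigma>)) ^ 3 * cmod (zeta (Complex \<sigma> t)) ^ 4 * cmod (zeta (Complex \<sigma> (2 * t))))"
proof -
  define K where "K = exp (4 * (\<Sum>n. real (Suc n) powr (-2)))"
  \<comment> \<open>\<open>F\<close> is multiplicative in g, so it passes from single Euler factors
    to their product and to zeta.\<close>
  define F where "F = (\<lambda>g. cmod (g (complex_of_real \<sigma>)) ^ 3 * cmod (g (Complex \<sigma> t)) ^ 4 * cmod (g (Complex \<sigma> (2 * t))))"
  have euler: "F (euler_prod N) \<le> K" for N
  proof -
    define P where "P = {p::nat. prime p \<and> p \<le> N}"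
    have [simp]: "finite P" by (simp add: P_def)
    have "F (euler_prod N) = (\<Prod>p\<in>P. F (\<lambda>s. 1 - of_nat p powr (-s)))"
      by (simp only: F_def euler_prod_def P_def prod_norm[symmetric] prod.distrib prod_power_distrib)
    also have "\<dots> \<le> (\<Prod>p\<in>P. exp (4 * real p powr (-2)))"
    proof (intro prod_mono conjI)
      fix p assume "p \<in> P"
      hence p: "p \<ge> 1" by (auto simp: P_def Suc_leI prime_gt_0_nat)
      define r where "r = real p powr (-\<sigma>)"
      define z where "z = exp (- \<i> * t * ln (real p))"
      have "of_nat p powr (- Complex \<sigma> (k * t)) = of_real r * exp (- \<i> * k * t * ln (real p))" for k
      proof -
        have "of_nat p powr (- Complex \<sigma> (k * t)) = exp (- Complex \<sigma> (k * t) * of_real (ln (real p)))"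
          using p by (simp add: powr_def Ln_of_nat)
        also have "- Complex \<sigma> (k * t) * of_real (ln (real p)) =
            of_real (- \<sigma> * ln (real p)) + (- \<i> * k * t * ln (real p))"
          by (simp add: Complex_eq algebra_simps)
        also have "exp \<dots> = of_real (exp (- \<sigma> * ln (real p))) * exp (- \<i> * k * t * ln (real p))"
          by (simp only: exp_add exp_of_real)
        also have "exp (- \<sigma> * ln (real p)) = r" using p by (simp add: r_def powr_def)
        finally show ?thesis .
      qed
      from this[of 0] this[of 1] this[of 2]
      have e: "of_nat p powr (- of_real \<sigma>) = complex_of_real r" "of_nat p powr (- Complex \<sigma> t) = of_real r * z"
        "of_nat p powr (- Complex \<sigma> (2 * t)) = of_real r * z ^ 2"
        by (simp_all add: z_def complex_of_real_def[symmetric] algebra_simps flip: exp_of_nat_mult)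
      have "F (\<lambda>s. 1 - of_nat p powr (-s)) \<le> (1 + r ^ 2) ^ 4"
        unfolding F_def e by (rule three_four_one_local) (auto simp: r_def z_def)
      also have "r ^ 2 \<le> real p powr (-2)"
        unfolding r_def using p \<sigma> by (simp add: powr_power powr_mono)
      hence "(1 + r ^ 2) ^ 4 \<le> (exp (real p powr (-2))) ^ 4"
        by (intro power_mono) (auto intro: order_trans[OF _ exp_ge_add_one_self])
      finally show "F (\<lambda>s. 1 - of_nat p powr (-s)) \<le> exp (4 * real p powr (-2))"
        by (simp flip: exp_of_nat_mult)
    qed (auto simp: F_def)
    also have "\<dots> = exp (4 * (\<Sum>p\<in>P. real p powr (-2)))"
      by (simp add: exp_sum sum_distrib_left)
    also have "(\<Sum>p\<in>P. real p powr (-2)) = (\<Sum>n\<in>(\<lambda>p. p - 1) ` P. real (Suc n) powr (-2))"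
    proof (subst sum.reindex)
      show "inj_on (\<lambda>p. p - 1) P" by (auto simp: inj_on_def P_def dest!: prime_gt_0_nat)
      show "(\<Sum>p\<in>P. real p powr -2) = sum ((\<lambda>n. real (Suc n) powr -2) \<circ> (\<lambda>p. p - 1)) P"
        by (intro sum.cong refl) (auto simp: P_def prime_gt_0_nat of_nat_diff Suc_leI)
    qed
    also have "\<dots> \<le> (\<Sum>n. real (Suc n) powr (-2))"
      by (intro sum_le_suminf summable_Suc_powr) auto
    finally show ?thesis by (simp add: K_def)
  qed
  have "(\<lambda>N. F (\<lambda>s. zeta s * euler_prod N s)) \<longlonglongrightarrow> norm (1::complex) ^ 3 * norm (1::complex) ^ 4 * norm (1::complex)"
    unfolding F_def using \<sigma> by (intro tendsto_intros euler_prod_tendsto) auto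
  moreover have "F (\<lambda>s. zeta s * euler_prod N s) \<le> K * F zeta" for N
  proof -
    have "F (\<lambda>s. zeta s * euler_prod N s) = F (euler_prod N) * F zeta"
      by (simp add: F_def norm_mult power_mult_distrib)
    also have "\<dots> \<le> K * F zeta" by (intro mult_right_mono euler) (auto simp: F_def)
    finally show ?thesis .
  qed
  ultimately have "norm (1::complex) ^ 3 * norm (1::complex) ^ 4 * norm (1::complex) \<le> K * F zeta"
    by (intro LIMSEQ_le_const2) auto
  thus ?thesis by (simp add: K_def F_def)
qed

text \<open>At \<sigma> = 1 + e a zero would supply e^4 against the e^(-3) of the pole, while zeta
  stays bounded near 1 + 2it; the right-hand side of the inequality would tend to 0.\<close>

lemma zeta_nonzero_Re_1:
  assumes t: "t \<noteq> 0"
  shows "zeta (Complex 1 t) \<noteq> 0"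
proof
  assume zero: "zeta (Complex 1 t) = 0"
  define K where "K = exp (4 * (\<Sum>n. real (Suc n) powr (-2)))"
  define S where "S = {s. Re s > 0} - {1::complex}"
  have holo: "zeta holomorphic_on S" and oS: "open S"
    using is_zeta_zeta by (auto simp: is_zeta_def S_def open_delete open_halfspace_Re_gt)
  have path: "((\<lambda>e. Complex (1 + e) u) \<longlongrightarrow> Complex 1 u) (at_right 0)" for u
    by (intro tendsto_Complex tendsto_eq_intros) auto
  have cont: "((\<lambda>e. zeta (Complex (1 + e) u)) \<longlongrightarrow> zeta (Complex 1 u)) (at_right 0)" if "u \<noteq> 0" for u
  proof (rule isCont_tendsto_compose[OF _ path])
    show "isCont zeta (Complex 1 u)"
      using holo oS that by (auto simp: S_def complex_eq_iff intro!: continuous_on_interior[OF holomorphic_on_imp_continuous_on] simp: interior_open)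
  qed
  have "(zeta has_field_derivative deriv zeta (Complex 1 t)) (at (Complex 1 t))"
    using holo oS t by (intro holomorphic_derivI[of _ S]) (auto simp: S_def complex_eq_iff)
  hence d: "((\<lambda>s. zeta s / (s - Complex 1 t)) \<longlongrightarrow> deriv zeta (Complex 1 t)) (at (Complex 1 t))"
    by (simp add: has_field_derivative_iff zero)
  have 1: "((\<lambda>e. zeta (Complex (1 + e) t) / of_real e) \<longlongrightarrow> deriv zeta (Complex 1 t)) (at_right 0)"
  proof -
    have "filterlim (\<lambda>e. Complex (1 + e) t) (at (Complex 1 t)) (at_right 0)"
      using path[of t] eventually_at_right_less[of "0::real"]
      by (auto simp: filterlim_at complex_eq_iff elim!: eventually_mono)
    from filterlim_compose[OF d this] show ?thesis
      by (simp add: complex_eq_iff Complex_eq algebra_simps)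
  qed
  have 2: "((\<lambda>e. of_real e * zeta (of_real (1 + e))) \<longlongrightarrow> 1) (at_right 0)"
  proof -
    have "filterlim (\<lambda>e. complex_of_real (1 + e)) (at 1) (at_right 0)"
      using eventually_at_right_less[of "0::real"]
      by (auto simp: filterlim_at elim!: eventually_mono intro!: tendsto_eq_intros)
    from filterlim_compose[OF zeta_reg_tendsto_1 this]
    show ?thesis
      by (rule Lim_transform_eventually)
         (use eventually_at_right_less[of "0::real"] in \<open>auto elim!: eventually_mono simp: zeta_reg_def\<close>)
  qed
  have "((\<lambda>e. K * (cmod (of_real e * zeta (of_real (1 + e))) ^ 3 * cmod (zeta (Complex (1 + e) t) / of_real e) ^ 4 *
       cmod (zeta (Complex (1 + e) (2 * t))) * e)) \<longlongrightarrow>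
       K * (norm (1::complex) ^ 3 * cmod (deriv zeta (Complex 1 t)) ^ 4 * cmod (zeta (Complex 1 (2 * t))) * 0)) (at_right 0)"
    using t by (intro tendsto_intros 1 2 cont) auto
  moreover have "eventually (\<lambda>e. 1 \<le> K * (cmod (of_real e * zeta (of_real (1 + e))) ^ 3 * cmod (zeta (Complex (1 + e) t) / of_real e) ^ 4 *
       cmod (zeta (Complex (1 + e) (2 * t))) * e)) (at_right 0)"
    using eventually_at_right_less[of "0::real"]
  proof eventually_elim
    case (elim e)
    have "cmod (of_real e * zeta (of_real (1 + e))) ^ 3 * cmod (zeta (Complex (1 + e) t) / of_real e) ^ 4 *
       cmod (zeta (Complex (1 + e) (2 * t))) * e = 
       cmod (zeta (of_real (1 + e))) ^ 3 * cmod (zeta (Complex (1 + e) t)) ^ 4 * cmod (zeta (Complex (1 + e) (2 * t)))"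
      using elim by (simp add: norm_mult norm_divide power_mult_distrib power_divide divide_simps power_numeral_reduce)
    thus ?case using three_four_one[of "1 + e" t] elim by (simp only: K_def)
  qed
  ultimately have "1 \<le> K * (norm (1::complex) ^ 3 * cmod (deriv zeta (Complex 1 t)) ^ 4 * cmod (zeta (Complex 1 (2 * t))) * 0)"
    by (intro tendsto_lowerbound) auto
  thus False by simp
qed

text \<open>\<open>riemann_hypothesis\<close> speaks of the open strip only; the line Re s = 1 and
  the half-plane beyond it are supplied by the two preceding nonvanishing results, the point 1 by
  the residue.\<close>

lemma zeta_reg_nonzero:
  assumes "riemann_hypothesis" "Re s > 1 / 2"
  shows "zeta_reg s \<noteq> 0"
proof (cases "s = 1")
  case False
  have "zeta s \<noteq> 0"
  proof (cases "Re s" "1::real" rule: linorder_cases)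
    case less
    thus ?thesis using assms unfolding riemann_hypothesis_def by force
  next
    case equal
    hence "Im s \<noteq> 0" using False by (auto simp: complex_eq_iff)
    thus ?thesis using zeta_nonzero_Re_1[of "Im s"] equal by (metis complex_surj)
  qed (use zeta_nonzero_Re_gt_1 in auto)
  thus ?thesis using False by (simp add: zeta_reg_def)
qed (auto simp: zeta_reg_def)

section \<open>Growth of \<open>1 / zeta\<close> under the Riemann hypothesis\<close>

text \<open>The map \<open>w / (2 * B - w)\<close> sends the half-plane Re w < B into the unit disc,
  so the Schwarz lemma bounds h; solving |w| <= (r / R) (2 B + |w|) for |w| gives the claim.\<close>

lemma borel_caratheodory:
  assumes f: "f holomorphic_on ball z0 R" and A: "\<And>z. z \<in> ball z0 R \<Longrightarrow> Re (f z) < A"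
    and r: "r < R" and z: "dist z0 z \<le> r"
  shows "cmod (f z - f z0) \<le> 2 * (A - Re (f z0)) * r / (R - r)"
proof -
  have r0: "0 \<le> r" using z zero_le_dist[of z0 z] by linarith
  hence R: "R > 0" using r by simp
  define B where "B = A - Re (f z0)"
  define w where "w = (\<lambda>u. f (z0 + of_real R * u) - f z0)"
  define h where "h = (\<lambda>u. w u / (of_real (2 * B) - w u))"
  have B: "B > 0" using A[of z0] R by (simp add: B_def)
  have in_ball: "z0 + of_real R * u \<in> ball z0 R" if "u \<in> ball 0 1" for u
    using that R by (simp add: dist_norm norm_mult)
  have Re_w: "Re (w u) < B" if "u \<in> ball 0 1" for u
    using A[OF in_ball[OF that]] by (simp add: w_def B_def)
  have w_holo: "w holomorphic_on ball 0 1"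
    unfolding w_def using in_ball
    by (intro holomorphic_intros holomorphic_on_compose_gen[OF _ f, unfolded o_def]) auto
  have nz: "of_real (2 * B) - w u \<noteq> 0" if "u \<in> ball 0 1" for u
    using Re_w[OF that] B by (auto simp: complex_eq_iff)
  have h_holo: "h holomorphic_on ball 0 1"
    unfolding h_def using nz by (intro holomorphic_intros w_holo) auto
  have "cmod (h u) < 1" if u: "u \<in> ball 0 1" for u
  proof -
    have "cmod (w u) ^ 2 < cmod (of_real (2 * B) - w u) ^ 2"
      using mult_strict_left_mono[OF Re_w[OF u] B]
      unfolding cmod_power2 by (simp add: power2_eq_square algebra_simps)
    hence "cmod (w u) < cmod (of_real (2 * B) - w u)"
      by (rule power2_less_imp_less) auto
    thus ?thesis using nz[OF u] by (simp add: h_def norm_divide divide_less_eq)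
  qed
  moreover have "h 0 = 0" by (simp add: h_def w_def)
  ultimately have h_le: "cmod (h u) \<le> cmod u" if "cmod u < 1" for u
    using that by (intro Schwarz_Lemma(1)[OF h_holo]) auto
  define u where "u = (z - z0) / of_real R"
  have u: "cmod u < 1" "cmod u \<le> r / R"
    using z r R by (auto simp: u_def norm_divide dist_norm norm_minus_commute divide_simps)
  have wu: "w u = f z - f z0" using R by (simp add: w_def u_def)
  have "cmod (w u) = cmod (h u) * cmod (of_real (2 * B) - w u)"
    using nz[of u] u by (simp add: h_def norm_divide)
  also have "\<dots> \<le> (r / R) * (2 * B + cmod (w u))"
    using h_le[OF u(1)] u norm_triangle_ineq4[of "of_real (2 * B)" "w u"] B r0 R
    by (intro mult_mono) auto
  finally have "cmod (w u) * (R - r) \<le> 2 * B * r" using R by (simp add: field_simps)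
  thus ?thesis using r by (simp add: wu B_def field_simps)
qed

text \<open>
  A substitute for Hadamard's three circles theorem: the first \<open>N\<close> terms of the Taylor series are
  estimated by Cauchy's inequality on the inner circle, the other terms on the outer circle.
\<close>

lemma norm_diff_le_two_circles:
  assumes f: "f holomorphic_on ball z0 R" and r: "0 < r1" "r1 < r3" "r3 < R" "0 < r2" "r2 < r3"
    and B1: "\<And>z. dist z0 z = r1 \<Longrightarrow> cmod (f z - f z0) \<le> B1"
    and B3: "\<And>z. dist z0 z = r3 \<Longrightarrow> cmod (f z - f z0) \<le> B3"
    and z: "dist z0 z \<le> r2"
  shows "cmod (f z - f z0) \<le> B1 * (\<Sum>n<N. (r2 / r1) ^ n) + B3 * ((r2 / r3) ^ N / (1 - r2 / r3))"
proof -
  define g where "g = (\<lambda>z. f z - f z0)"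
  define a where "a = (\<lambda>n. (deriv ^^ n) g z0 / fact n * (z - z0) ^ n)"
  define q where "q = r2 / r3"
  have q: "0 \<le> q" "q < 1" using r by (auto simp: q_def)
  have g: "g holomorphic_on ball z0 R" unfolding g_def by (intro holomorphic_intros f)
  have a_le: "cmod (a n) \<le> B * (r2 / r) ^ n"
    if "0 < r" "r < R" "\<And>z. dist z0 z = r \<Longrightarrow> cmod (g z) \<le> B" for n r B
  proof -
    have sub: "cball z0 r \<subseteq> ball z0 R" using that by auto
    have "cmod ((deriv ^^ n) g z0) \<le> fact n * B / r ^ n"
      using that
      by (intro Cauchy_inequality holomorphic_on_subset[OF g] holomorphic_on_imp_continuous_on
            order_trans[OF ball_subset_cball sub] sub) (auto simp: dist_norm)
    moreover have "cmod (z - z0) ^ n \<le> r2 ^ n"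
      using z by (intro power_mono) (auto simp: dist_norm norm_minus_commute)
    moreover have "0 \<le> fact n * B / r ^ n" using calculation(1) by (rule order_trans[OF norm_ge_zero])
    ultimately have "cmod ((deriv ^^ n) g z0) / fact n * cmod (z - z0) ^ n \<le> (fact n * B / r ^ n) / fact n * r2 ^ n"
      by - (rule mult_mono[OF divide_right_mono _ divide_nonneg_nonneg], (assumption | simp)+)
    thus ?thesis by (simp add: a_def norm_mult norm_divide norm_power power_divide)
  qed
  have sums: "a sums g z"
    unfolding a_def using z r by (intro holomorphic_power_series[OF g]) auto
  have a3: "cmod (a (n + N)) \<le> B3 * q ^ N * q ^ n" for n
    using a_le[of r3 B3 "n + N"] r B3 unfolding g_def q_def by (simp add: power_add mult_ac)
  have geo: "(\<lambda>n. B3 * q ^ N * q ^ n) sums (B3 * q ^ N * (1 / (1 - q)))"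
    using q by (intro sums_mult geometric_sums) auto
  have "g z = (\<Sum>n. a (n + N)) + (\<Sum>n<N. a n)"
    using sums suminf_split_initial_segment[of a N] by (simp add: sums_iff)
  also have "cmod \<dots> \<le> B3 * q ^ N * (1 / (1 - q)) + (\<Sum>n<N. B1 * (r2 / r1) ^ n)"
  proof (rule norm_triangle_mono)
    show "cmod (\<Sum>n. a (n + N)) \<le> B3 * q ^ N * (1 / (1 - q))"
      using norm_suminf_le[of "\<lambda>n. a (n + N)", OF a3 sums_summable[OF geo]] sums_unique[OF geo] by simp
    show "cmod (\<Sum>n<N. a n) \<le> (\<Sum>n<N. B1 * (r2 / r1) ^ n)"
      using r B1 unfolding g_def[symmetric] by (intro sum_norm_le a_le) (auto simp: g_def)
  qed
  finally show ?thesis by (simp add: g_def q_def sum_distrib_left)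
qed

text \<open>Each 1 / (n + 2)^2 is at most the telescoping difference of 1 / (n + 3/2). The total
  must be below 1, to keep zeta away from 0 as well.\<close>

lemma norm_zeta_minus_1_le:
  assumes s: "Re s \<ge> 2"
  shows "cmod (zeta s - 1) \<le> 2 / 3"
proof -
  have "(\<lambda>n. of_nat (Suc n) powr (-s)) sums zeta s"
    using is_zeta_zeta s unfolding is_zeta_def by auto
  hence sums: "(\<lambda>n. of_nat (Suc (Suc n)) powr (-s)) sums (zeta s - 1)"
    using sums_Suc_iff[of "\<lambda>n. of_nat (Suc n) powr (-s)" "zeta s - 1"] by simp
  define g where "g = (\<lambda>n. 1 / (real n + 3 / 2))"
  have "g \<longlonglongrightarrow> 0" unfolding g_def by real_asymp
  from telescope_sums'[OF this] have tele: "(\<lambda>n. g n - g (Suc n)) sums (2 / 3)"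
    by (simp add: g_def)
  have le: "cmod (of_nat (Suc (Suc n)) powr (-s)) \<le> g n - g (Suc n)" for n
  proof -
    have "cmod (of_nat (Suc (Suc n)) powr (-s)) = real (Suc (Suc n)) powr (- Re s)"
      using norm_powr_real_powr[of "of_nat (Suc (Suc n))" "-s"] by simp
    also have "\<dots> \<le> real (Suc (Suc n)) powr (-2)"
      using s by (intro powr_mono) auto
    also have "\<dots> = 1 / (real n + 2) ^ 2"
      by (simp add: powr_minus powr_numeral field_simps)
    also have "\<dots> \<le> g n - g (Suc n)"
    proof -
      have "g n - g (Suc n) = 1 / ((real n + 3 / 2) * (real n + 5 / 2))"
        by (simp add: g_def field_simps)
      moreover have "(real n + 3 / 2) * (real n + 5 / 2) \<le> (real n + 2) ^ 2"
        by (simp add: power2_eq_square algebra_simps)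
      ultimately show ?thesis by (simp add: frac_le)
    qed
    finally show ?thesis .
  qed
  have "cmod (\<Sum>n. of_nat (Suc (Suc n)) powr (-s)) \<le> (\<Sum>n. g n - g (Suc n))"
    by (rule norm_suminf_le[OF le]) (use tele in \<open>simp add: sums_iff\<close>)
  thus ?thesis using tele sums by (simp only: sums_iff)
qed

text \<open>\<open>1 / zeta\<close> would be wrong at the pole, where the value of \<open>zeta\<close> is unspecified.\<close>

definition zeta_inv :: "complex \<Rightarrow> complex" where
  "zeta_inv s = (s - 1) / zeta_reg s"

lemma zeta_inv_eq: "s \<noteq> 1 \<Longrightarrow> zeta_inv s = 1 / zeta s"
  by (simp add: zeta_inv_def zeta_reg_def)

lemma holomorphic_zeta_inv:
  assumes "riemann_hypothesis"
  shows "zeta_inv holomorphic_on {s. Re s > 1 / 2}"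
  unfolding zeta_inv_def using zeta_reg_nonzero[OF assms]
  by (intro holomorphic_intros holomorphic_on_subset[OF holomorphic_zeta_reg]) auto

text \<open>
  The Borel-Caratheodory theorem bounds \<open>log zeta\<close> around \<open>3 + i Im s\<close>: by a constant in \<open>Re s > 2\<close>
  and by a multiple of \<open>log \<bar>Im s\<bar>\<close> further to the left, and the latter bound counts only with the
  factor \<open>q\<^sup>N\<close>.
\<close>

lemma inverse_zeta_le_large:
  assumes rh: "riemann_hypothesis" and \<epsilon>: "\<epsilon> > 0"
  shows "\<exists>C\<ge>0. \<forall>s. 9 / 10 \<le> Re s \<and> Re s \<le> 2 \<and> \<bar>Im s\<bar> \<ge> 4 \<longrightarrow> cmod (1 / zeta s) \<le> C * \<bar>Im s\<bar> powr \<epsilon>"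
proof -
  define K where "K = (\<Sum>n. real (Suc n) powr (- (3 / 5) - 1))"
  have K: "K \<ge> 0" unfolding K_def by (intro suminf_nonneg summable_Suc_powr) auto
  \<comment> \<open>The outer bound 46 l gets the factor q^N / (1 - q) with q = 21/23. As 46 / (1 -
    q) = 529, this N reduces it to \<open>\<epsilon> * l\<close>.\<close>
  obtain N where N: "(21 / 23) ^ N < \<epsilon> / 529"
    using real_arch_pow_inv[of "\<epsilon> / 529" "21 / 23"] \<epsilon> by auto
  define S where "S = (\<Sum>n<N. (21 / 5 :: real) ^ n)"
  define C where "C = exp (2 + 6 * S + \<epsilon> * (ln (1 + 3 * K) + 3))"
  have "cmod (1 / zeta s) \<le> C * \<bar>Im s\<bar> powr \<epsilon>"
    if s: "9 / 10 \<le> Re s" "Re s \<le> 2" "\<bar>Im s\<bar> \<ge> 4" for s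
  proof -
    define \<tau> where "\<tau> = \<bar>Im s\<bar>"
    have \<tau>: "\<tau> \<ge> 4" using s by (simp add: \<tau>_def)
    define z0 where "z0 = Complex 3 (Im s)"
    \<comment> \<open>The radius keeps the disc right of 3/5, where no zeros are left, and |Im s| >=
      4 keeps it away from the pole. The point s itself has distance at most 3 - 9/10 = 21/10 from
      the centre.\<close>
    have B: "3 / 5 < Re u" "u \<noteq> 1" "cmod (u - 1) \<ge> 1" "cmod u \<le> 3 * \<tau>" if "u \<in> ball z0 (12 / 5)" for u
    proof -
      have d: "cmod (z0 - u) < 12 / 5" using that by (simp add: dist_norm)
      show "3 / 5 < Re u" using abs_Re_le_cmod[of "z0 - u"] d by (simp add: z0_def)
      have "\<bar>Im u\<bar> \<ge> 1" using abs_Im_le_cmod[of "z0 - u"] d s by (simp add: z0_def)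
      thus "cmod (u - 1) \<ge> 1" using abs_Im_le_cmod[of "u - 1"] by simp
      thus "u \<noteq> 1" by auto
      have "cmod z0 \<le> 3 + \<tau>" using cmod_le[of z0] by (simp add: z0_def \<tau>_def)
      thus "cmod u \<le> 3 * \<tau>" using d norm_triangle_ineq2[of u z0] \<tau> by (simp add: norm_minus_commute)
    qed
    have "zeta holomorphic_on {s. Re s > 0} - {1}" using is_zeta_zeta by (simp add: is_zeta_def)
    hence holo: "zeta holomorphic_on ball z0 (12 / 5)"
      by (rule holomorphic_on_subset) (use B in force)
    moreover have nz: "zeta u \<noteq> 0" if "u \<in> ball z0 (12 / 5)" for u
      using zeta_reg_nonzero[OF rh, of u] B[OF that] by (auto simp: zeta_reg_def)
    ultimately obtain g where g: "g holomorphic_on ball z0 (12 / 5)"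
      "\<And>u. u \<in> ball z0 (12 / 5) \<Longrightarrow> exp (g u) = zeta u"
      using holomorphic_logarithm_exists[of "ball z0 (12 / 5)" zeta z0] by auto
    have Re_g: "Re (g u) = ln (cmod (zeta u))" if "u \<in> ball z0 (12 / 5)" for u
      using g(2)[OF that] by (metis ln_exp norm_exp_eq_Re)
    have z0_half: "Re (g z0) \<ge> -2"
    proof -
      have "cmod (zeta z0) \<ge> 1 / 3"
        using norm_zeta_minus_1_le[of z0] norm_triangle_ineq2[of 1 "1 - zeta z0"]
        by (simp add: z0_def norm_minus_commute)
      hence "ln (1 / 3) \<le> ln (cmod (zeta z0))" by (intro ln_mono) auto
      moreover have "ln (1 / 3) = - ln (3::real)" by (simp add: ln_div)
      moreover have "ln 3 \<le> (2::real)" using ln_le_minus_one[of "3::real"] by simp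
      ultimately show ?thesis using Re_g[of z0] by simp
    qed
    have inner: "cmod (g u - g z0) \<le> 6" if "dist z0 u = 1 / 2" for u
    proof -
      have "Re (g v) < 1" if "v \<in> ball z0 1" for v
      proof -
        have "dist z0 v < 1" using that by simp
        hence "Re v \<ge> 2" using abs_Re_le_cmod[of "z0 - v"] by (simp add: z0_def dist_norm)
        hence "cmod (zeta v) \<le> 5 / 3"
          using norm_zeta_minus_1_le[of v] norm_triangle_ineq2[of "zeta v" 1] by simp
        moreover have v: "v \<in> ball z0 (12 / 5)" using that by simp
        ultimately have "ln (cmod (zeta v)) \<le> 5 / 3 - 1"
          using ln_le_minus_one[of "cmod (zeta v)"] nz[OF v] by simp
        thus ?thesis using Re_g[OF v] by simp
      qed
      hence "cmod (g u - g z0) \<le> 2 * (1 - Re (g z0)) * (1 / 2) / (1 - 1 / 2)"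
        using that by (intro borel_caratheodory[of g z0 1 1] holomorphic_on_subset[OF g(1)]) auto
      also have "\<dots> \<le> 6" using z0_half by simp
      finally show ?thesis .
    qed
    have outer: "cmod (g u - g z0) \<le> 46 * (ln ((1 + 3 * K) * \<tau>) + 3)" if "dist z0 u = 23 / 10" for u
    proof -
      have "Re (g v) < ln ((1 + 3 * K) * \<tau>) + 1" if v: "v \<in> ball z0 (12 / 5)" for v
      proof -
        have "cmod (zeta v) \<le> cmod (1 / (v - 1)) + cmod (zeta v - 1 / (v - 1))"
          using norm_triangle_sub[of "zeta v" "1 / (v - 1)"] by simp
        also have "\<dots> \<le> 1 + cmod v * K"
          unfolding K_def using B[OF v]
          by (intro add_mono norm_zeta_diff_pole_le) (auto simp: norm_divide divide_le_eq)
        also have "\<dots> \<le> \<tau> + 3 * \<tau> * K" using B[OF v] \<tau> K by (intro add_mono mult_right_mono) auto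
        finally have "cmod (zeta v) \<le> (1 + 3 * K) * \<tau>" by (simp add: algebra_simps)
        hence "ln (cmod (zeta v)) \<le> ln ((1 + 3 * K) * \<tau>)"
          using nz[OF v] by (intro ln_mono) auto
        thus ?thesis using Re_g[OF v] by simp
      qed
      hence "cmod (g u - g z0) \<le> 2 * (ln ((1 + 3 * K) * \<tau>) + 1 - Re (g z0)) * (23 / 10) / (12 / 5 - 23 / 10)"
        using that by (intro borel_caratheodory[OF g(1)]) auto
      also have "\<dots> \<le> 46 * (ln ((1 + 3 * K) * \<tau>) + 3)" using z0_half by simp
      finally show ?thesis .
    qed
    have s_z0: "dist z0 s \<le> 21 / 10"
    proof -
      have "z0 - s = of_real (3 - Re s)" by (simp add: z0_def complex_eq_iff)
      thus ?thesis using s by (simp add: dist_norm del: of_real_diff)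
    qed
    define l where "l = ln ((1 + 3 * K) * \<tau>) + 3"
    have l: "l = ln (1 + 3 * K) + ln \<tau> + 3" "l \<ge> 0" using K \<tau> by (auto simp: l_def ln_mult)
    have "cmod (g s - g z0) \<le> 6 * (\<Sum>n<N. (21 / 10 / (1 / 2)) ^ n) +
            46 * l * ((21 / 10 / (23 / 10)) ^ N / (1 - 21 / 10 / (23 / 10)))"
      by (rule norm_diff_le_two_circles[OF g(1) _ _ _ _ _ inner _ s_z0])
         (use outer in \<open>auto simp: l_def\<close>)
    also have "\<dots> = 6 * S + l * (529 * (21 / 23) ^ N)" by (simp add: S_def)
    also have "\<dots> \<le> 6 * S + l * \<epsilon>"
      using N l(2) by (intro add_left_mono mult_left_mono) auto
    finally have "Re (g z0) - Re (g s) \<le> 6 * S + l * \<epsilon>"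
      using abs_Re_le_cmod[of "g s - g z0"] by simp
    hence *: "- Re (g s) \<le> 2 + 6 * S + \<epsilon> * l" using z0_half by (simp add: mult.commute)
    have "s \<in> ball z0 (12 / 5)" using s_z0 by simp
    hence "cmod (1 / zeta s) = exp (- Re (g s))"
      using g(2)[of s] by (metis exp_minus inverse_eq_divide norm_exp_eq_Re norm_inverse)
    also have "\<dots> \<le> exp (2 + 6 * S + \<epsilon> * l)" using * by simp
    also have "\<dots> = C * \<tau> powr \<epsilon>"
      using \<tau> by (simp add: C_def l powr_def flip: exp_add) (simp add: algebra_simps)
    finally show ?thesis by (simp add: \<tau>_def)
  qed
  moreover have "C \<ge> 0" by (simp add: C_def)
  ultimately show ?thesis by blast
qed

text \<open>The heights below 4 form a compact rectangle, on which \<open>zeta_inv\<close> is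
  continuous even at the former pole.\<close>

lemma zeta_inv_le:
  assumes rh: "riemann_hypothesis" and \<epsilon>: "\<epsilon> > 0"
  obtains C where "C \<ge> 0"
    "\<And>s. 9 / 10 \<le> Re s \<Longrightarrow> Re s \<le> 2 \<Longrightarrow> cmod (zeta_inv s) \<le> C * (1 + \<bar>Im s\<bar>) powr \<epsilon>"
proof -
  obtain C1 where C1: "C1 \<ge> 0"
    "\<And>s. 9 / 10 \<le> Re s \<Longrightarrow> Re s \<le> 2 \<Longrightarrow> \<bar>Im s\<bar> \<ge> 4 \<Longrightarrow> cmod (1 / zeta s) \<le> C1 * \<bar>Im s\<bar> powr \<epsilon>"
    using inverse_zeta_le_large[OF assms] by blast
  define X where "X = cbox (Complex (9 / 10) (-4)) (Complex 2 4)"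
  have "continuous_on X zeta_inv"
    by (rule holomorphic_on_imp_continuous_on, rule holomorphic_on_subset[OF holomorphic_zeta_inv[OF rh]])
       (auto simp: X_def in_cbox_complex_iff)
  hence "compact (zeta_inv ` X)" by (intro compact_continuous_image) (auto simp: X_def)
  then obtain C2 where C2: "\<And>s. s \<in> X \<Longrightarrow> cmod (zeta_inv s) \<le> C2"
    using compact_imp_bounded[of "zeta_inv ` X"] by (auto simp: bounded_iff)
  show ?thesis
  proof (rule that[of "max C1 C2"])
    show "max C1 C2 \<ge> 0" using C1 by simp
    fix s assume s: "9 / 10 \<le> Re s" "Re s \<le> 2"
    show "cmod (zeta_inv s) \<le> max C1 C2 * (1 + \<bar>Im s\<bar>) powr \<epsilon>"
    proof (cases "\<bar>Im s\<bar> \<ge> 4")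
      case True
      hence "cmod (zeta_inv s) \<le> C1 * \<bar>Im s\<bar> powr \<epsilon>"
        using C1(2)[of s] s by (subst zeta_inv_eq) auto
      also have "\<dots> \<le> max C1 C2 * (1 + \<bar>Im s\<bar>) powr \<epsilon>"
        using C1 \<epsilon> by (intro mult_mono powr_mono2) auto
      finally show ?thesis .
    next
      case False
      hence "s \<in> X" using s by (auto simp: X_def in_cbox_complex_iff)
      hence "cmod (zeta_inv s) \<le> max C1 C2 * 1" using C2[of s] by simp
      also have "\<dots> \<le> max C1 C2 * (1 + \<bar>Im s\<bar>) powr \<epsilon>"
        using C1 \<epsilon> by (intro mult_left_mono ge_one_powr_ge_zero) auto
      finally show ?thesis .
    qed
  qed
qed

section \<open>The integrand\<close>

lemma norm_of_nat_powr: "n > 0 \<Longrightarrow> cmod (of_nat n powr s) = real n powr Re s"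
  using norm_powr_real_powr[of "of_nat n" s] by simp

text \<open>Turns numerical bounds for powers with exponent 4/5 into comparisons of
  rationals.\<close>

lemma le_powr_four_fifths:
  fixes a b \<sigma> :: real
  assumes "a ^ 5 \<le> b ^ 4" "a \<ge> 0" "b \<ge> 1" "\<sigma> \<ge> 4 / 5"
  shows "a \<le> b powr \<sigma>"
proof -
  have "(b powr (4 / 5)) ^ 5 = b powr 4"
    using assms by (simp add: powr_power)
  also have "\<dots> = b ^ 4" using assms by (intro powr_numeral) auto
  finally have "a ^ 5 \<le> (b powr (4 / 5)) ^ 5" using assms by simp
  hence "a \<le> b powr (4 / 5)" using assms by (subst (asm) power_mono_iff) auto
  also have "\<dots> \<le> b powr \<sigma>" using assms by (intro powr_mono) auto
  finally show ?thesis .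
qed

lemma norm_of_nat_powr_ge:
  assumes "n \<ge> 3" "Re s \<ge> 4 / 5"
  shows "cmod (of_nat n powr s) \<ge> 12 / 5"
proof -
  have "12 / 5 \<le> (3::real) powr Re s" using assms by (intro le_powr_four_fifths) (auto simp: power_divide)
  also have "\<dots> \<le> real n powr Re s" using assms by (intro powr_mono2) auto
  finally show ?thesis using assms by (simp add: norm_of_nat_powr)
qed

text \<open>The reciprocal of an Euler factor of \<open>D\<close> extends holomorphically beyond the line \<open>Re s = 1\<close>.\<close>

definition D_inv_factor :: "nat \<Rightarrow> complex \<Rightarrow> complex" where
  "D_inv_factor p s = (if prime p \<and> p > 2 then 1 - 1 / (of_nat p powr s - 1) ^ 2 else 1)"

definition D_inv :: "complex \<Rightarrow> complex" where
  "D_inv s = lim (\<lambda>N. \<Prod>p<N. D_inv_factor p s)"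

lemma norm_D_inv_factor_diff_1_le:
  assumes s: "Re s \<ge> 4 / 5"
  shows "cmod (D_inv_factor p s - 1) \<le> 3 * real p powr (- (8 / 5))"
proof (cases "prime p \<and> p > 2")
  case True
  define r where "r = real p powr Re s"
  have r: "r \<ge> 12 / 5" "cmod (of_nat p powr s) = r"
    using norm_of_nat_powr_ge[of p s] True s by (auto simp: r_def norm_of_nat_powr)
  \<comment> \<open>By r >= 12/5 the 1 is at most 5/12 of r; the resulting (12/7)^2 is just below
    3.\<close>
  have "7 / 12 * r \<le> r - 1" using r by simp
  also have "r - 1 \<le> cmod (of_nat p powr s - 1)"
    using norm_triangle_ineq2[of "of_nat p powr s" 1] r by simp
  finally have *: "7 / 12 * r \<le> cmod (of_nat p powr s - 1)" .
  have "cmod (D_inv_factor p s - 1) = 1 / cmod (of_nat p powr s - 1) ^ 2"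
    using True by (simp add: D_inv_factor_def norm_divide norm_power)
  also have "\<dots> \<le> 1 / (7 / 12 * r) ^ 2"
    using * r by (intro divide_left_mono power_mono mult_pos_pos zero_less_power) auto
  also have "\<dots> \<le> 3 / r ^ 2" using r by (simp add: power_mult_distrib divide_simps)
  also have "\<dots> = 3 * real p powr (- 2 * Re s)"
    using True by (simp add: r_def powr_power powr_minus field_simps)
  also have "\<dots> \<le> 3 * real p powr (- (8 / 5))"
    using True s by (intro mult_left_mono powr_mono) auto
  finally show ?thesis .
qed (auto simp: D_inv_factor_def)

lemma holomorphic_D_inv_factor: "D_inv_factor p holomorphic_on {s. Re s > 4 / 5}"
proof (cases "prime p \<and> p > 2")
  case True
  have "of_nat p powr s \<noteq> 1" if "Re s > 4 / 5" for s
    using norm_of_nat_powr_ge[of p s] True that by auto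
  hence "(\<lambda>s. 1 - 1 / (of_nat p powr s - 1) ^ 2) holomorphic_on {s. Re s > 4 / 5}"
    using True by (intro holomorphic_intros) auto
  thus ?thesis using True by (simp add: D_inv_factor_def[abs_def])
next
  case False
  hence "D_inv_factor p = (\<lambda>_. 1)" by (auto simp: D_inv_factor_def fun_eq_iff)
  thus ?thesis by simp
qed

lemma summable_powr_8_5: "summable (\<lambda>n. 3 * real n powr (- (8 / 5)))"
  by (intro summable_mult) (simp add: summable_real_powr_iff)

lemma uniform_limit_D_inv:
  assumes A: "compact A" "A \<subseteq> {s. Re s > 4 / 5}"
  shows "uniform_limit A (\<lambda>N s. \<Prod>p<N. D_inv_factor p s) D_inv sequentially"
proof -
  have "uniformly_convergent_on A (\<lambda>N s. \<Prod>p<N. D_inv_factor p s)"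
  proof (rule uniformly_convergent_on_prod')
    show "continuous_on A (D_inv_factor p)" for p
      using holomorphic_on_imp_continuous_on[OF holomorphic_D_inv_factor] A(2)
      by (rule continuous_on_subset)
    have "uniform_limit A (\<lambda>N s. \<Sum>p<N. cmod (D_inv_factor p s - 1)) (\<lambda>s. \<Sum>p. cmod (D_inv_factor p s - 1)) sequentially"
      by (rule Weierstrass_m_test[OF _ summable_powr_8_5])
         (use A norm_D_inv_factor_diff_1_le in force)
    thus "uniformly_convergent_on A (\<lambda>N s. \<Sum>p<N. cmod (D_inv_factor p s - 1))"
      by (auto simp: uniformly_convergent_on_def)
  qed (use A in auto)
  thus ?thesis by (simp add: uniformly_convergent_uniform_limit_iff D_inv_def[abs_def])
qed

lemma D_inv_LIMSEQ:
  assumes "Re s > 4 / 5"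
  shows "(\<lambda>N. \<Prod>p<N. D_inv_factor p s) \<longlonglongrightarrow> D_inv s"
  using uniform_limit_D_inv[of "{s}"] assms by (auto intro: tendsto_uniform_limitI)

lemma holomorphic_D_inv: "D_inv holomorphic_on {s. Re s > 4 / 5}"
proof (rule holomorphic_uniform_sequence)
  show "open {s. Re s > 4 / 5}" by (rule open_halfspace_Re_gt)
  show "(\<lambda>s. \<Prod>p<N. D_inv_factor p s) holomorphic_on {s. Re s > 4 / 5}" for N
    by (intro holomorphic_intros holomorphic_D_inv_factor)
  fix s :: complex assume "s \<in> {s. Re s > 4 / 5}"
  then obtain d where "d > 0" "cball s d \<subseteq> {s. Re s > 4 / 5}"
    using open_contains_cball[of "{s. Re s > 4 / 5}"] open_halfspace_Re_gt by blast
  thus "\<exists>d>0. cball s d \<subseteq> {s. Re s > 4 / 5} \<and>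
      uniform_limit (cball s d) (\<lambda>N s. \<Prod>p<N. D_inv_factor p s) D_inv sequentially"
    by (intro exI[of _ d] conjI uniform_limit_D_inv) auto
qed

lemma norm_D_inv_le:
  assumes s: "Re s > 4 / 5"
  shows "cmod (D_inv s) \<le> exp (\<Sum>n. 3 * real n powr (- (8 / 5)))"
proof (rule LIMSEQ_le_const2[OF tendsto_norm[OF D_inv_LIMSEQ[OF s]]], intro exI allI impI)
  fix N
  have "cmod (\<Prod>p<N. D_inv_factor p s) = (\<Prod>p<N. cmod (D_inv_factor p s))"
    by (rule prod_norm[symmetric])
  also have "\<dots> \<le> (\<Prod>p<N. exp (3 * real p powr (- (8 / 5))))"
  proof (intro prod_mono conjI)
    fix p
    have "cmod (D_inv_factor p s) \<le> 1 + cmod (D_inv_factor p s - 1)"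
      using norm_triangle_ineq[of 1 "D_inv_factor p s - 1"] by simp
    also have "\<dots> \<le> 1 + 3 * real p powr (- (8 / 5))"
      using norm_D_inv_factor_diff_1_le[of s p] s by simp
    also have "\<dots> \<le> exp (3 * real p powr (- (8 / 5)))" by (rule exp_ge_add_one_self)
    finally show "cmod (D_inv_factor p s) \<le> exp (3 * real p powr (- (8 / 5)))" .
  qed auto
  also have "\<dots> = exp (\<Sum>p<N. 3 * real p powr (- (8 / 5)))" by (simp add: exp_sum)
  also have "\<dots> \<le> exp (\<Sum>n. 3 * real n powr (- (8 / 5)))"
    by (simp only: exp_le_cancel_iff, rule sum_le_suminf[OF summable_powr_8_5]) auto
  finally show "cmod (\<Prod>p<N. D_inv_factor p s) \<le> exp (\<Sum>n. 3 * real n powr (- (8 / 5)))" .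
qed

text \<open>With q = \<open>p powr s\<close>, the factors 1 + 1 / (q (q - 2)) and 1 - 1 / (q - 1)^2
  are reciprocal. The convergence of the first product must be shown before its value can be read as
  a limit of partial products.\<close>

lemma D_prod_eq:
  assumes s: "Re s > 1"
  shows "D_prod s * D_inv s = 1"
proof -
  define d where "d = (\<lambda>p. if prime p \<and> p > 2
      then 1 + (\<Sum>\<nu>. 2 ^ \<nu> / of_nat p powr (of_nat (\<nu> + 2) * s)) else (1 :: complex))"
  define q where "q = (\<lambda>p::nat. of_nat p powr s :: complex)"
  have q: "cmod (q p) \<ge> real p" "cmod (q p) \<ge> 3" if "p > 2" for p
  proof -
    have "real p powr 1 \<le> real p powr Re s" using s that by (intro powr_mono) auto
    thus "cmod (q p) \<ge> real p" using that by (simp add: q_def norm_of_nat_powr)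
    thus "cmod (q p) \<ge> 3" using that by linarith
  qed
  have d: "d p = (if prime p \<and> p > 2 then 1 + 1 / (q p * (q p - 2)) else 1)" for p
    using D_factor[OF s, of p] unfolding d_def q_def by auto
  have bound: "cmod (d p - 1) \<le> 3 * real p powr (-2)" for p
  proof (cases "prime p \<and> p > 2")
    case True
    have "cmod (q p) / 3 \<le> cmod (q p) - 2" using q[of p] True by simp
    also have "\<dots> \<le> cmod (q p - 2)" using norm_triangle_ineq2[of "q p" 2] by simp
    finally have "cmod (q p) / 3 \<le> cmod (q p - 2)" .
    hence "real p * (real p / 3) \<le> cmod (q p) * cmod (q p - 2)"
      using q[of p] True by (intro mult_mono) auto
    hence "1 / (cmod (q p) * cmod (q p - 2)) \<le> 1 / (real p * (real p / 3))"
      using True by (intro frac_le) auto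
    also have "\<dots> = 3 * real p powr (-2)"
      using True by (simp add: powr_minus powr_numeral power2_eq_square field_simps)
    finally show ?thesis using True by (simp add: d norm_divide norm_mult)
  qed (auto simp: d)
  have "summable (\<lambda>p. 3 * real p powr (-2))"
    by (intro summable_mult) (simp add: summable_real_powr_iff)
  hence "summable (\<lambda>p. cmod (d p - 1))"
    by (rule summable_comparison_test') (use bound in simp)
  hence "convergent_prod d"
    by (intro abs_convergent_prod_imp_convergent_prod) (simp add: abs_convergent_prod_conv_summable)
  hence "(\<lambda>N. \<Prod>p\<le>N. d p) \<longlonglongrightarrow> D_prod s"
    unfolding D_prod_def d_def by (rule convergent_prod_LIMSEQ)
  moreover have "(\<lambda>N. \<Prod>p\<le>N. D_inv_factor p s) \<longlonglongrightarrow> D_inv s"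
    using LIMSEQ_Suc[OF D_inv_LIMSEQ[of s]] s by (simp add: lessThan_Suc_atMost)
  ultimately have "(\<lambda>N. (\<Prod>p\<le>N. d p) * (\<Prod>p\<le>N. D_inv_factor p s)) \<longlonglongrightarrow> D_prod s * D_inv s"
    by (rule tendsto_mult)
  moreover have "d p * D_inv_factor p s = 1" for p
  proof (cases "prime p \<and> p > 2")
    case True
    have "q p \<noteq> 0" "q p \<noteq> 2" "q p \<noteq> 1" using q(2)[of p] True by auto
    hence "(1 + 1 / (q p * (q p - 2))) * (1 - 1 / (q p - 1) ^ 2) = 1"
      by (simp add: divide_simps) (simp add: power2_eq_square algebra_simps)
    thus ?thesis using True by (simp add: d D_inv_factor_def q_def)
  qed (auto simp: d D_inv_factor_def)
  hence "(\<lambda>N. (\<Prod>p\<le>N. d p) * (\<Prod>p\<le>N. D_inv_factor p s)) = (\<lambda>N. 1)"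
    by (simp flip: prod.distrib)
  ultimately show ?thesis by (simp add: LIMSEQ_const_iff)
qed

text \<open>The continuation of the integrand, without the factor \<open>x\<^sup>s / s\<close>, beyond the line \<open>Re s = 1\<close>.\<close>

definition twin_kernel :: "nat \<Rightarrow> complex \<Rightarrow> complex" where
  "twin_kernel j s = zeta_inv s * (inverse ((1 - 1 / 2 powr s) ^ 2) * D_inv s *
     inverse (\<Prod>p | prime p \<and> 2 < p \<and> p \<le> nth_prime j. 1 - 2 / of_nat p powr s))"

text \<open>Needed only on the original path; further left the kernel takes the place of the
  integrand.\<close>

lemma integrand_eq:
  assumes "Re s > 1"
  shows "integrand j s = of_real (x_of j) powr s / s * twin_kernel j s"
proof -
  have "1 / D_prod s = D_inv s"
    using D_prod_eq[OF assms] by (metis inverse_eq_divide inverse_unique)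
  moreover have "1 / zeta s = zeta_inv s" using assms by (subst zeta_inv_eq) auto
  ultimately show ?thesis
    by (simp add: integrand_def twin_kernel_def field_simps flip: \<open>1 / D_prod s = D_inv s\<close> \<open>1 / zeta s = zeta_inv s\<close>)
qed

section \<open>Bounds for the kernel\<close>

lemma norm_one_minus_half_powr_ge:
  assumes "Re s \<ge> 4 / 5"
  shows "cmod (1 - 1 / 2 powr s) \<ge> 7 / 17"
proof -
  have "cmod (2 powr s) = 2 powr Re s" using norm_of_nat_powr[of 2 s] by simp
  moreover have "17 / 10 \<le> (2::real) powr Re s"
    using assms by (intro le_powr_four_fifths) (auto simp: power_divide)
  ultimately have "cmod (1 / 2 powr s) \<le> 10 / 17"
    by (simp add: norm_divide divide_simps)
  thus ?thesis using norm_triangle_ineq2[of 1 "1 / 2 powr s"] by simp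
qed

lemma norm_one_minus_two_powr_ge:
  assumes "Re s \<ge> 4 / 5" "p > 2"
  shows "cmod (1 - 2 / of_nat p powr s) \<ge> 1 / 6"
proof -
  have "cmod (2 / of_nat p powr s) \<le> 5 / 6"
    using norm_of_nat_powr_ge[of p s] assms by (simp add: norm_divide divide_simps)
  thus ?thesis using norm_triangle_ineq2[of 1 "2 / of_nat p powr s"] by simp
qed

lemma holomorphic_twin_kernel:
  assumes "riemann_hypothesis"
  shows "twin_kernel j holomorphic_on {s. Re s > 4 / 5}"
proof -
  have "1 - 1 / 2 powr s \<noteq> 0" if "Re s > 4 / 5" for s
    using norm_one_minus_half_powr_ge[of s] that by auto
  moreover have "1 - 2 / of_nat p powr s \<noteq> 0" if "Re s > 4 / 5" "p > 2" for s p
    using norm_one_minus_two_powr_ge[of s p] that by auto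
  ultimately show ?thesis
    unfolding twin_kernel_def
    by (intro holomorphic_intros holomorphic_on_subset[OF holomorphic_zeta_inv[OF assms]] holomorphic_D_inv) auto
qed

text \<open>At most j odd primes occur, each costing a factor 6; the other 6 bounds (17/7)^2 from
  the prime 2. Such a loss is affordable because x outgrows every \<open>a ^ j\<close>.\<close>

lemma norm_twin_kernel_le:
  assumes s: "Re s > 4 / 5" and j: "j \<ge> 1"
  shows "cmod (twin_kernel j s) \<le> cmod (zeta_inv s) * (6 * exp (\<Sum>n. 3 * real n powr (- (8 / 5))) * 6 ^ j)"
proof -
  define P where "P = {p. prime p \<and> 2 < p \<and> p \<le> nth_prime j}"
  have "card P \<le> card {p. prime p \<and> p \<le> nth_prime j}" by (intro card_mono) (auto simp: P_def)
  hence card: "card P \<le> j" using card_primes_le_nth_prime[OF j] by simp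
  have "cmod (inverse ((1 - 1 / 2 powr s) ^ 2)) = inverse (cmod (1 - 1 / 2 powr s) ^ 2)"
    by (simp add: norm_inverse norm_power)
  also have "\<dots> \<le> inverse ((7 / 17) ^ 2)"
    using norm_one_minus_half_powr_ge[of s] s by (intro le_imp_inverse_le power_mono) auto
  also have "\<dots> \<le> 6" by (simp add: power2_eq_square)
  finally have 1: "cmod (inverse ((1 - 1 / 2 powr s) ^ 2)) \<le> 6" .
  have "cmod (inverse (\<Prod>p\<in>P. 1 - 2 / of_nat p powr s)) = (\<Prod>p\<in>P. inverse (cmod (1 - 2 / of_nat p powr s)))"
    by (simp only: norm_inverse prod_norm[symmetric] prod_inversef[symmetric] o_def)
  also have "\<dots> \<le> (\<Prod>p\<in>P. 6)"
  proof (intro prod_mono conjI)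
    fix p assume "p \<in> P"
    hence "inverse (cmod (1 - 2 / of_nat p powr s)) \<le> inverse (1 / 6)"
      using norm_one_minus_two_powr_ge[of s p] s by (intro le_imp_inverse_le) (auto simp: P_def)
    thus "inverse (cmod (1 - 2 / of_nat p powr s)) \<le> 6" by simp
  qed auto
  also have "\<dots> \<le> 6 ^ j" using card by (simp add: power_increasing)
  finally have 2: "cmod (inverse (\<Prod>p\<in>P. 1 - 2 / of_nat p powr s)) \<le> 6 ^ j" .
  show ?thesis
    unfolding twin_kernel_def P_def[symmetric] norm_mult
    using norm_D_inv_le[OF s] 1 2 by (intro mult_mono mult_left_mono) auto
qed

section \<open>The contour shift\<close>

text \<open>A primitive exists on the convex half-plane, so all four integrals are differences of
  its values at the corners.\<close>

lemma contour_integral_shift: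
  assumes f: "f holomorphic_on {s. Re s > a'}" and "a' < a" "a' < b"
  shows "contour_integral (linepath (Complex b (-T)) (Complex b T)) f =
    contour_integral (linepath (Complex b (-T)) (Complex a (-T))) f +
    contour_integral (linepath (Complex a (-T)) (Complex a T)) f +
    contour_integral (linepath (Complex a T) (Complex b T)) f"
proof -
  define S where "S = {s. Re s > a'}"
  have S: "convex S" "open S"
    unfolding S_def by (rule convex_halfspace_Re_gt open_halfspace_Re_gt)+
  obtain F where F: "\<And>s. s \<in> S \<Longrightarrow> (F has_field_derivative f s) (at s within S)"
    using holomorphic_convex_primitive'[OF S] f unfolding S_def by metis
  have *: "contour_integral (linepath z w) f = F w - F z" if "z \<in> S" "w \<in> S" for z w
  proof (rule contour_integral_unique)
    show "(f has_contour_integral F w - F z) (linepath z w)"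
      using contour_integral_primitive[where S = S and f = F and f' = f and g = "linepath z w"] F
        closed_segment_subset[OF that S(1)] by simp
  qed
  have "Complex a u \<in> S" "Complex b u \<in> S" for u using assms by (auto simp: S_def)
  thus ?thesis by (simp add: *)
qed

text \<open>The majorant is chosen for its explicit primitive \<open>arsinh\<close>: the decay of 1
  / s along the line costs only a logarithm of T.\<close>

lemma norm_contour_integral_vertical_le:
  assumes f: "continuous_on (closed_segment (Complex a (-T)) (Complex a T)) f" and T: "T > 0"
    and B: "\<And>t. \<bar>t\<bar> \<le> T \<Longrightarrow> cmod (f (Complex a t)) \<le> B / sqrt (t ^ 2 + 1)"
  shows "cmod (contour_integral (linepath (Complex a (-T)) (Complex a T)) f) \<le> 2 * B * arsinh T"
proof -
  define \<gamma> where "\<gamma> = linepath (Complex a (-T)) (Complex a T)"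
  define u where "u = (\<lambda>x. T * (2 * x - 1))"
  have \<gamma>: "\<gamma> x = Complex a (u x)" for x
    by (simp add: \<gamma>_def linepath_def u_def complex_eq_iff algebra_simps)
  have "(f has_contour_integral contour_integral \<gamma> f) \<gamma>"
    unfolding \<gamma>_def by (rule has_contour_integral_integral[OF contour_integrable_continuous_linepath[OF f]])
  hence *: "((\<lambda>x. f (\<gamma> x) * (Complex a T - Complex a (-T))) has_integral contour_integral \<gamma> f) {0..1}"
    unfolding \<gamma>_def has_contour_integral_linepath .
  have "((\<lambda>x. B / sqrt ((u x) ^ 2 + 1) * (2 * T)) has_integral (B * arsinh (u 1) - B * arsinh (u 0))) {0..1}"
  proof (rule fundamental_theorem_of_calculus)
    fix x :: real
    have "(u has_real_derivative 2 * T) (at x within {0..1})"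
      unfolding u_def by (auto intro!: derivative_eq_intros)
    from DERIV_cmult[OF DERIV_chain'[OF this arsinh_real_has_field_derivative], of B]
    have "((\<lambda>x. B * arsinh (u x)) has_real_derivative (B / sqrt ((u x) ^ 2 + 1) * (2 * T))) (at x within {0..1})"
      by simp
    thus "((\<lambda>x. B * arsinh (u x)) has_vector_derivative (B / sqrt ((u x) ^ 2 + 1) * (2 * T))) (at x within {0..1})"
      by (simp add: has_real_derivative_iff_has_vector_derivative)
  qed auto
  hence **: "((\<lambda>x. B / sqrt ((u x) ^ 2 + 1) * (2 * T)) has_integral (2 * B * arsinh T)) {0..1}"
    by (simp add: u_def arsinh_minus_real mult.assoc)
  have bound: "cmod (f (\<gamma> x) * (Complex a T - Complex a (-T))) \<le> B / sqrt ((u x) ^ 2 + 1) * (2 * T)" if "x \<in> {0..1}" for x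
  proof -
    have "\<bar>u x\<bar> \<le> T * 1"
      unfolding u_def abs_mult using that T by (intro mult_mono) auto
    moreover have "Complex a T - Complex a (-T) = of_real (2 * T) * \<i>" by (simp add: complex_eq_iff)
    hence "cmod (Complex a T - Complex a (-T)) = 2 * T" using T by (simp add: norm_mult)
    ultimately show ?thesis using mult_right_mono[OF B[of "u x"], of "2 * T"] T by (simp add: norm_mult \<gamma>)
  qed
  have "cmod (integral {0..1} (\<lambda>x. f (\<gamma> x) * (Complex a T - Complex a (-T)))) \<le>
      integral {0..1} (\<lambda>x. B / sqrt ((u x) ^ 2 + 1) * (2 * T))"
    using * ** by (intro integral_norm_bound_integral bound) auto
  thus ?thesis
    unfolding integral_unique[OF *] integral_unique[OF **] unfolding \<gamma>_def .
qed

lemma norm_linepath_Im_eq_le: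
  assumes f: "continuous_on (closed_segment (Complex a t) (Complex b t)) f"
    and B: "\<And>s. Im s = t \<Longrightarrow> min a b \<le> Re s \<Longrightarrow> Re s \<le> max a b \<Longrightarrow> cmod (f s) \<le> B" "B \<ge> 0"
    and ab: "\<bar>b - a\<bar> \<le> 1"
  shows "cmod (contour_integral (linepath (Complex a t) (Complex b t)) f) \<le> B"
proof -
  have "cmod (contour_integral (linepath (Complex a t) (Complex b t)) f) \<le> B * cmod (Complex b t - Complex a t)"
    using has_contour_integral_integral[OF contour_integrable_continuous_linepath[OF f]] B(2)
  proof (rule has_contour_integral_bound_linepath)
    fix s assume "s \<in> closed_segment (Complex a t) (Complex b t)"
    thus "cmod (f s) \<le> B"
      by (intro B) (auto simp: closed_segment_same_Im closed_segment_eq_real_ivl split: if_splits)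
  qed
  also have "cmod (Complex b t - Complex a t) = \<bar>b - a\<bar>" by (simp add: cmod_def)
  also have "B * \<bar>b - a\<bar> \<le> B * 1" using ab B(2) by (intro mult_left_mono)
  finally show ?thesis by simp
qed

lemma norm_contour_integral_integrand_le:
  assumes rh: "riemann_hypothesis"
  obtains M where "M \<ge> 0"
    "\<And>j T. j \<ge> 1 \<Longrightarrow> x_of j > 0 \<Longrightarrow> T \<ge> 1 \<Longrightarrow>
       cmod (contour_integral (linepath (Complex (21 / 20) (-T)) (Complex (21 / 20) T)) (integrand j)) \<le>
       M * 6 ^ j * (1 + T) powr (1 / 20) *
         (2 * (max 1 (x_of j) powr (21 / 20) / T) + 3 * (x_of j powr (9 / 10) * arsinh T))"
proof -
  obtain C where C: "C \<ge> 0"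
    "\<And>s. 9 / 10 \<le> Re s \<Longrightarrow> Re s \<le> 2 \<Longrightarrow> cmod (zeta_inv s) \<le> C * (1 + \<bar>Im s\<bar>) powr (1 / 20)"
    using zeta_inv_le[OF rh, of "1 / 20"] by auto
  define M where "M = C * (6 * exp (\<Sum>n. 3 * real n powr (- (8 / 5))))"
  have M: "M \<ge> 0" unfolding M_def using C(1) by (intro mult_nonneg_nonneg) auto
  show ?thesis
  proof (rule that[OF M])
    fix j :: nat and T :: real
    assume j: "j \<ge> 1" and x0: "x_of j > 0" and T: "T \<ge> 1"
    define x where "x = x_of j"
    define N where "N = M * 6 ^ j * (1 + T) powr (1 / 20)"
    have N: "N \<ge> 0" using M by (simp add: N_def)
    have x: "x > 0" using x0 by (simp add: x_def)
    define F where "F = (\<lambda>s. of_real x powr s / s * twin_kernel j s)"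
    have F_holo: "F holomorphic_on {s. Re s > 4 / 5}"
      unfolding F_def using x by (intro holomorphic_intros holomorphic_twin_kernel[OF rh]) auto
    have twin_kernel: "cmod (twin_kernel j s) \<le> N" if "9 / 10 \<le> Re s" "Re s \<le> 2" "\<bar>Im s\<bar> \<le> T" for s
    proof -
      have "cmod (twin_kernel j s) \<le> cmod (zeta_inv s) * (6 * exp (\<Sum>n. 3 * real n powr (- (8 / 5))) * 6 ^ j)"
        using that j by (intro norm_twin_kernel_le) auto
      also have "\<dots> \<le> (C * (1 + T) powr (1 / 20)) * (6 * exp (\<Sum>n. 3 * real n powr (- (8 / 5))) * 6 ^ j)"
      proof (intro mult_right_mono)
        have "cmod (zeta_inv s) \<le> C * (1 + \<bar>Im s\<bar>) powr (1 / 20)" using that by (intro C)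
        also have "\<dots> \<le> C * (1 + T) powr (1 / 20)"
          using that C(1) by (intro mult_left_mono powr_mono2) auto
        finally show "cmod (zeta_inv s) \<le> C * (1 + T) powr (1 / 20)" .
      qed auto
      also have "\<dots> = N" by (simp add: N_def M_def)
      finally show ?thesis .
    qed
    have norm_F: "cmod (F s) = x powr Re s / cmod s * cmod (twin_kernel j s)" for s
      using x by (simp add: F_def norm_mult norm_divide norm_powr_real_powr)
    have cont: "continuous_on A F" if "A \<subseteq> {s. Re s > 4 / 5}" for A
      by (rule holomorphic_on_imp_continuous_on[OF holomorphic_on_subset[OF F_holo that]])
    have half: "closed_segment z w \<subseteq> {s. Re s > 4 / 5}" if "Re z > 4 / 5" "Re w > 4 / 5" for z w
      using that by (intro closed_segment_subset convex_halfspace_Re_gt) auto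
    define H where "H = N * (max 1 x powr (21 / 20) / T)"
    have H: "H \<ge> 0" using N T by (simp add: H_def)
    have horizontal: "cmod (F s) \<le> H" if "9 / 10 \<le> Re s" "Re s \<le> 21 / 20" "\<bar>Im s\<bar> = T" for s
    proof -
      \<comment> \<open>For x < 1 the power is not largest at the right end of the side, hence the
        maximum with 1.\<close>
      have "x powr Re s \<le> max 1 x powr Re s" using that x by (intro powr_mono2) auto
      also have "\<dots> \<le> max 1 x powr (21 / 20)" using that by (intro powr_mono) auto
      finally have "x powr Re s / cmod s \<le> max 1 x powr (21 / 20) / T"
        using that T abs_Im_le_cmod[of s] by (intro frac_le) auto
      thus ?thesis
        unfolding norm_F H_def using twin_kernel[of s] that T
        by (subst mult.commute, intro mult_mono) auto
    qed
    have vertical: "cmod (F (Complex (9 / 10) t)) \<le> (3 / 2 * N * x powr (9 / 10)) / sqrt (t ^ 2 + 1)"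
      if "\<bar>t\<bar> \<le> T" for t
    proof -
      \<comment> \<open>2/3 is a convenient constant below the abscissa 9/10; its inverse leads to
        the 3 in the final bound.\<close>
      have "2 / 3 * sqrt (t ^ 2 + 1) = sqrt ((2 / 3) ^ 2 * (t ^ 2 + 1))"
        by (simp add: real_sqrt_mult)
      also have "\<dots> \<le> cmod (Complex (9 / 10) t)"
        unfolding complex_norm
      proof (intro real_sqrt_le_mono)
        have "0 \<le> t ^ 2" "(2 / 3) ^ 2 * (t ^ 2 + 1) = 4 / 9 * t ^ 2 + 4 / 9" "(9 / 10 :: real) ^ 2 = 81 / 100"
          by (simp_all add: power_divide)
        thus "(2 / 3) ^ 2 * (t ^ 2 + 1) \<le> (9 / 10) ^ 2 + t ^ 2"
          by linarith
      qed
      finally have *: "2 / 3 * sqrt (t ^ 2 + 1) \<le> cmod (Complex (9 / 10) t)" .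
      have "sqrt (t ^ 2 + 1) > 0" by (simp add: add_nonneg_pos)
      hence "cmod (F (Complex (9 / 10) t)) \<le> x powr (9 / 10) / (2 / 3 * sqrt (t ^ 2 + 1)) * N"
        unfolding norm_F using * twin_kernel[of "Complex (9 / 10) t"] that
        by (intro mult_mono frac_le) auto
      thus ?thesis by (simp add: mult_ac)
    qed
    have "contour_integral (linepath (Complex (21 / 20) (-T)) (Complex (21 / 20) T)) (integrand j) =
          contour_integral (linepath (Complex (21 / 20) (-T)) (Complex (21 / 20) T)) F"
    proof (rule contour_integral_eq)
      fix s assume "s \<in> path_image (linepath (Complex (21 / 20) (-T)) (Complex (21 / 20) T))"
      hence "Re s = 21 / 20" by (auto simp: closed_segment_same_Re)
      thus "integrand j s = F s" unfolding F_def x_def by (intro integrand_eq) simp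
    qed
    also have "\<dots> = contour_integral (linepath (Complex (21 / 20) (-T)) (Complex (9 / 10) (-T))) F +
        contour_integral (linepath (Complex (9 / 10) (-T)) (Complex (9 / 10) T)) F +
        contour_integral (linepath (Complex (9 / 10) T) (Complex (21 / 20) T)) F"
      by (rule contour_integral_shift[OF F_holo]) auto
    also have "cmod \<dots> \<le> H + 2 * (3 / 2 * N * x powr (9 / 10)) * arsinh T + H"
      using T H by (intro norm_triangle_mono norm_linepath_Im_eq_le norm_contour_integral_vertical_le
            cont half vertical horizontal) auto
    also have "\<dots> = N * (2 * (max 1 x powr (21 / 20) / T) + 3 * (x powr (9 / 10) * arsinh T))"
      by (simp add: H_def algebra_simps)
    finally show "cmod (contour_integral (linepath (Complex (21 / 20) (-T)) (Complex (21 / 20) T)) (integrand j)) \<le>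
       M * 6 ^ j * (1 + T) powr (1 / 20) *
         (2 * (max 1 (x_of j) powr (21 / 20) / T) + 3 * (x_of j powr (9 / 10) * arsinh T))"
      by (simp only: N_def x_def)
  qed
qed

section \<open>The contradiction\<close>

lemma arsinh_le: "T \<ge> 0 \<Longrightarrow> arsinh T \<le> ln (1 + 2 * T :: real)"
proof -
  assume T: "T \<ge> 0"
  have "sqrt (T ^ 2 + 1) \<le> T + 1"
    using T by (intro real_le_lsqrt) (auto simp: power2_eq_square algebra_simps)
  thus ?thesis using T by (simp add: arsinh_real_def add_pos_nonneg add_nonneg_pos)
qed

text \<open>Every term is compared with the main term separately, so that the constants A1 to A4 may
  have any sign. The tightest comparison is x / ln x against x / (ln x)^(2/3).\<close>

lemma eventually_error_less:
  fixes k A1 A2 A3 A4 :: real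
  assumes k: "k > 0"
  shows "eventually (\<lambda>x. sqrt (6 * x + 1) + 4 * (6 * x + 1) / ln (6 * x) +
      (A1 * (x powr (21 / 20) / (k * x)) + A2 * (x * ln x ^ 3 / (k * x)) + A3) +
      A4 * (x powr (1 / 100) * (1 + k * x) powr (1 / 20) *
         (2 * (x powr (21 / 20) / (k * x)) + 3 * (x powr (9 / 10) * ln (1 + 2 * (k * x))))) <
      x / (2 * ln x) powr (2 / 3)) at_top"
proof -
  define g where "g = (\<lambda>x::real. x / (2 * ln x) powr (2 / 3))"
  have g_pos: "eventually (\<lambda>x. g x > 0) at_top"
    unfolding g_def by real_asymp
  have 1: "((\<lambda>x. (sqrt (6 * x + 1) + 4 * (6 * x + 1) / ln (6 * x)) / g x) \<longlongrightarrow> 0) at_top"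
    unfolding g_def by real_asymp
  have 2: "((\<lambda>x. (x powr (21 / 20) / (k * x)) / g x) \<longlongrightarrow> 0) at_top"
    unfolding g_def using k by real_asymp
  have 3: "((\<lambda>x. (x * ln x ^ 3 / (k * x)) / g x) \<longlongrightarrow> 0) at_top"
    unfolding g_def using k by real_asymp
  have 4: "((\<lambda>x. 1 / g x) \<longlongrightarrow> 0) at_top"
    unfolding g_def by real_asymp
  have 5: "((\<lambda>x. (x powr (1 / 100) * (1 + k * x) powr (1 / 20) *
         (2 * (x powr (21 / 20) / (k * x)) + 3 * (x powr (9 / 10) * ln (1 + 2 * (k * x))))) / g x) \<longlongrightarrow> 0) at_top"
    unfolding g_def using k by real_asymp
  have "((\<lambda>x. (sqrt (6 * x + 1) + 4 * (6 * x + 1) / ln (6 * x)) / g x +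
      (A1 * ((x powr (21 / 20) / (k * x)) / g x) + A2 * ((x * ln x ^ 3 / (k * x)) / g x) + A3 * (1 / g x)) +
      A4 * ((x powr (1 / 100) * (1 + k * x) powr (1 / 20) *
         (2 * (x powr (21 / 20) / (k * x)) + 3 * (x powr (9 / 10) * ln (1 + 2 * (k * x))))) / g x))
      \<longlongrightarrow> 0 + (A1 * 0 + A2 * 0 + A3 * 0) + A4 * 0) at_top"
    by (intro tendsto_add tendsto_mult tendsto_const 1 2 3 4 5)
  hence "eventually (\<lambda>x. (sqrt (6 * x + 1) + 4 * (6 * x + 1) / ln (6 * x)) / g x +
      (A1 * ((x powr (21 / 20) / (k * x)) / g x) + A2 * ((x * ln x ^ 3 / (k * x)) / g x) + A3 * (1 / g x)) +
      A4 * ((x powr (1 / 100) * (1 + k * x) powr (1 / 20) *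
         (2 * (x powr (21 / 20) / (k * x)) + 3 * (x powr (9 / 10) * ln (1 + 2 * (k * x))))) / g x) < 1) at_top"
    by (rule order_tendstoD) auto
  with g_pos show ?thesis
  proof eventually_elim
    case (elim x)
    define a b c d where "a = sqrt (6 * x + 1) + 4 * (6 * x + 1) / ln (6 * x)"
      and "b = x powr (21 / 20) / (k * x)" and "c = x * ln x ^ 3 / (k * x)"
      and "d = x powr (1 / 100) * (1 + k * x) powr (1 / 20) *
         (2 * (x powr (21 / 20) / (k * x)) + 3 * (x powr (9 / 10) * ln (1 + 2 * (k * x))))"
    have "(a + (A1 * b + A2 * c + A3) + A4 * d) / g x =
        a / g x + (A1 * (b / g x) + A2 * (c / g x) + A3 * (1 / g x)) + A4 * (d / g x)"
      by (simp add: add_divide_distrib)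
    also have "\<dots> < 1" using elim(2) by (simp only: a_def b_def c_def d_def)
    finally have "a + (A1 * b + A2 * c + A3) + A4 * d < g x" using elim(1) by (simp add: divide_less_eq)
    thus ?case by (simp only: a_def b_def c_def d_def g_def)
  qed
qed

theorem corollary3p5:
  shows "\<not> (riemann_hypothesis \<and> twin_prime_formula)"
proof
  assume "riemann_hypothesis \<and> twin_prime_formula"
  hence rh: "riemann_hypothesis" and formula: "twin_prime_formula" by auto
  obtain M where M: "M \<ge> 0"
    "\<And>j T. j \<ge> 1 \<Longrightarrow> x_of j > 0 \<Longrightarrow> T \<ge> 1 \<Longrightarrow>
       cmod (contour_integral (linepath (Complex (21 / 20) (-T)) (Complex (21 / 20) T)) (integrand j)) \<le>
       M * 6 ^ j * (1 + T) powr (1 / 20) *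
         (2 * (max 1 (x_of j) powr (21 / 20) / T) + 3 * (x_of j powr (9 / 10) * arsinh T))"
    using norm_contour_integral_integrand_le[OF rh] by blast
  have "(21 / 20 :: real) > 1" by simp
  from formula[unfolded twin_prime_formula_def, THEN spec, THEN mp, OF this]
  obtain c \<kappa> C1 C2 C3 where c: "0 < c" "c < 1" "0 < \<kappa>" and
    err: "\<forall>j T. j \<ge> 1 \<and> x_of j > 0 \<and> T > 0 \<and> T \<ge> \<kappa> * x_of j powr c \<longrightarrow>
      cmod (twin_error j (21 / 20) T) \<le>
         C1 * (cmod (zeta (of_real (21 / 20))) ^ 3 * x_of j powr (21 / 20) / T) +
         C2 * (x_of j * ln (x_of j) ^ 3 / T) + C3"
    by blast
  \<comment> \<open>With T = k x and x >= 1, both T >= 1 and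
    \<open>T \<ge> \<kappa> * x powr c\<close> hold, whatever the unknown c < 1.\<close>
  define k where "k = \<kappa> + 1"
  have k: "k \<ge> 1" "k > 0" using c by (auto simp: k_def)
  define Z where "Z = cmod (zeta (of_real (21 / 20))) ^ 3"
  define E where "E = (\<lambda>x. sqrt (6 * x + 1) + 4 * (6 * x + 1) / ln (6 * x) +
      (C1 * Z * (x powr (21 / 20) / (k * x)) + C2 * (x * ln x ^ 3 / (k * x)) + C3) +
      M * (x powr (1 / 100) * (1 + k * x) powr (1 / 20) *
         (2 * (x powr (21 / 20) / (k * x)) + 3 * (x powr (9 / 10) * ln (1 + 2 * (k * x))))))"
  \<comment> \<open>The base \<open>6 ^ 100\<close> is what makes \<open>6 ^ j\<close> at most
    \<open>x powr (1 / 100)\<close>.\<close>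
  have large: "eventually (\<lambda>j. x_of j \<ge> (6 ^ 100) ^ j \<and> x_of j \<le> L_prod (nth_prime j)) at_top"
    by (rule eventually_x_of_ge) simp
  have "filterlim (\<lambda>j. (6 ^ 100 :: real) ^ j) at_top sequentially"
    by real_asymp
  hence "filterlim x_of at_top sequentially"
    by (rule filterlim_at_top_mono) (use large in \<open>auto elim!: eventually_mono\<close>)
  moreover have "eventually (\<lambda>x. E x < x / (2 * ln x) powr (2 / 3)) at_top"
    unfolding E_def by (rule eventually_error_less) fact
  ultimately have "eventually (\<lambda>j. E (x_of j) < x_of j / (2 * ln (x_of j)) powr (2 / 3)) sequentially"
    by (rule eventually_compose_filterlim[rotated])
  hence "eventually (\<lambda>j. False) sequentially"
    using large eventually_ge_at_top[of 2]
  proof eventually_elim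
    case (elim j)
    define x where "x = x_of j"
    define T where "T = k * x"
    have j: "j \<ge> 2" using elim by simp
    have x: "x \<ge> (6 ^ 100) ^ j" "x \<le> L_prod (nth_prime j)" using elim by (auto simp: x_def)
    have "(1::real) \<le> (6 ^ 100) ^ j" by (intro one_le_power) simp
    hence x1: "x \<ge> 1" using x by linarith
    have T1: "T \<ge> 1" unfolding T_def using mult_mono[of 1 k 1 x] k x1 by simp
    \<comment> \<open>Turns the lower bound for \<open>R0 j\<close>, which is in terms of j, into
      one in terms of ln x.\<close>
    have j_le: "real j \<le> ln x"
    proof -
      have "exp (real j) = exp 1 ^ j" by (simp flip: exp_of_nat_mult)
      also have "\<dots> \<le> (6 ^ 100) ^ j" using exp_le by (intro power_mono) auto
      finally show ?thesis using x(1) x1 by (simp add: ln_ge_iff)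
    qed
    have six: "6 ^ j \<le> x powr (1 / 100)"
    proof -
      have "(6 ^ 100) ^ j = (6 ^ j) powr (100 :: real)"
        by (subst powr_numeral) (simp_all only: zero_le_power zero_le_numeral power_mult[symmetric] mult.commute)
      hence "(6::real) ^ j = ((6 ^ 100) ^ j) powr (1 / 100)" by (simp only: powr_powr) simp
      also have "\<dots> \<le> x powr (1 / 100)" using x by (intro powr_mono2) auto
      finally show ?thesis .
    qed
    define I where "I = contour_integral (linepath (Complex (21 / 20) (-T)) (Complex (21 / 20) T)) (integrand j)"
    have "x powr c \<le> x powr 1" using x1 c by (intro powr_mono) auto
    hence "\<kappa> * x powr c \<le> T" unfolding T_def k_def using c x1 by (intro mult_mono) auto
    hence err': "cmod (twin_error j (21 / 20) T) \<le>
        C1 * Z * (x powr (21 / 20) / (k * x)) + C2 * (x * ln x ^ 3 / (k * x)) + C3"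
      using err[rule_format, of j T] j x1 T1 by (simp add: x_def T_def Z_def)
    have "cmod I \<le> M * 6 ^ j * (1 + T) powr (1 / 20) *
         (2 * (max 1 x powr (21 / 20) / T) + 3 * (x powr (9 / 10) * arsinh T))"
      using M(2)[of j T] j x1 T1 by (simp only: I_def x_def)
    also have "max 1 x = x" using x1 by simp
    also have "M * 6 ^ j * (1 + T) powr (1 / 20) * (2 * (x powr (21 / 20) / T) + 3 * (x powr (9 / 10) * arsinh T)) \<le>
      M * x powr (1 / 100) * (1 + T) powr (1 / 20) * (2 * (x powr (21 / 20) / T) + 3 * (x powr (9 / 10) * ln (1 + 2 * T)))"
    proof -
      have "arsinh T \<ge> 0" unfolding arsinh_real_def using T1 by (intro ln_ge_zero add_increasing2) auto
      thus ?thesis using M(1) six T1 x1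
        by (intro mult_mono add_mono arsinh_le mult_nonneg_nonneg add_nonneg_nonneg divide_nonneg_nonneg) auto
    qed
    finally have I_le: "cmod I \<le> M * (x powr (1 / 100) * (1 + k * x) powr (1 / 20) *
         (2 * (x powr (21 / 20) / (k * x)) + 3 * (x powr (9 / 10) * ln (1 + 2 * (k * x)))))"
      by (simp only: T_def mult.assoc)
    have "of_real (R0 j) = of_nat (twin_pi (6 * x + 1)) - twin_error j (21 / 20) T - 1 / (2 * of_real pi * \<i>) * I"
      unfolding twin_error_def I_def x_def by simp
    hence "cmod (of_real (R0 j)) \<le> real (twin_pi (6 * x + 1)) + cmod (twin_error j (21 / 20) T) + cmod (1 / (2 * of_real pi * \<i>) * I)"
      using norm_triangle_ineq4[of "of_nat (twin_pi (6 * x + 1)) - twin_error j (21 / 20) T" "1 / (2 * of_real pi * \<i>) * I"]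
        norm_triangle_ineq4[of "of_nat (twin_pi (6 * x + 1))" "twin_error j (21 / 20) T"] by simp
    moreover have "cmod (1 / (2 * of_real pi * \<i>) * I) \<le> 1 * cmod I"
      unfolding norm_mult using pi_ge_two by (intro mult_right_mono) (auto simp: norm_divide norm_mult)
    ultimately have "R0 j \<le> E x"
      using twin_pi_le[OF x1] err' I_le unfolding E_def norm_of_real by linarith
    moreover have "x / (2 * ln x) powr (2 / 3) \<le> x / (2 * real j) powr (2 / 3)"
      using j_le j x1 by (intro divide_left_mono powr_mono2 mult_pos_pos) auto
    moreover have "\<dots> \<le> R0 j"
      using R0_ge[of j] j x x1 by (simp add: x_def)
    ultimately show ?case using elim(1) by (simp add: x_def)
  qed
  thus False by simp
qed

end
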